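(* Let $d\ge 3$ be a natural number and put $D=2^d$. Let $X,Y\in\mathbf{R}$ with $\lfloor Y\rfloor>d$. Let $f\colon(X,X+Y]\to\mathbf{R}$ be a real function with continuous derivatives up to order $d$, and assume $0<\lambda\le f^{(d)}(x)\le\Lambda$ for all $X<x\le X+Y$. Then \[ \Bigl|\frac{1}{Y}\sum_{X<n\le X+Y}e(f(n))\Bigr|\le \max\Bigl\{A_d\Bigl(\frac{\Lambda}{\lambda Y}\Bigr)^{2/D},\ B_d\Bigl(\frac{\Lambda^2}{\lambda}\Bigr)^{1/(D-2)},\ C_d(\lambda Y^d)^{-2/D}\Bigr\}, \] where \[ A_d=B\sqrt{2}\,(d-2)^{2/D},\quad B_d=B\Bigl(\frac{3^4}{2^3}\Bigl(\frac23\Bigr)^{2d}2^{D/4}A^2B^{-2}\Bigr)^{1/(D-2)},\quad C_d=B\Bigl(\frac{AD}{B}\Bigr)^{4/D}(d-2)^{2(d-2)/D}. \]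
   Context: $e(x)=e^{2\pi i x}$; the sum runs over integers $n$. The constants are $A=\frac{2}{\sqrt{\pi}}\bigl(1+\sqrt{1+3\pi/8}\bigr)=2.7936\ldots$ and $B=2+2\sqrt2=4.8284\ldots$. *)

theory Defs
  imports "HOL-Analysis.Analysis"
begin

definition e :: "real \<Rightarrow> complex" where
  "e x = exp (2 * of_real pi * \<i> * of_real x)"

definition constA :: real where
  "constA = 2 / sqrt pi * (1 + sqrt (1 + 3 * pi / 8))"

definition constB :: real where
  "constB = 2 + 2 * sqrt 2"

definition A_d :: "nat \<Rightarrow> real" where
  "A_d d = constB * sqrt 2 * (real d - 2) powr (2 / 2 ^ d)"

definition B_d :: "nat \<Rightarrow> real" where
  "B_d d = constB * ((3 ^ 4 / 2 ^ 3) * (2 / 3) ^ (2 * d) * 2 powr (2 ^ d / 4)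
              * constA\<^sup>2 * constB powr (-2)) powr (1 / (2 ^ d - 2))"

definition C_d :: "nat \<Rightarrow> real" where
  "C_d d = constB * (constA * 2 ^ d / constB) powr (4 / 2 ^ d)
              * (real d - 2) powr (2 * (real d - 2) / 2 ^ d)"

end

theory Submission
  imports Defs
begin

text \<open>
  Put \<open>q = d - 2\<close>, \<open>Q = 2 ^ q\<close> and let \<open>R\<close> be the right-hand side divided by \<open>constB\<close>.
  Applying the Weyl--van der Corput inequality \<open>q\<close> times with differencing lengths
  \<open>H\<^sub>1, \<dots>, H\<^sub>q\<close> bounds the \<open>2 ^ q\<close>-th power of the normalised sum by terms \<open>1 / H\<^sub>k\<close>
  and a weighted mean of sums over the differenced functions, whose second derivatives lie between
  \<open>lam * h\<^sub>1 \<cdots> h\<^sub>q\<close> and \<open>Lam * h\<^sub>1 \<cdots> h\<^sub>q\<close>. The second derivative test, obtained from Kuzmin--Landau on each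
  unit period of the first difference, bounds this mean by \<open>constA\<close> times a term growing and a term
  decreasing with the product of the \<open>H\<^sub>k\<close>. One takes \<open>H\<^sub>k \<ge> R powr (- (2 ^ k)) / 2\<close>
  with product as large as the growing term allows, subject to \<open>H\<^sub>k \<le> Y - 1\<close>. That such \<open>H\<^sub>k\<close> exist
  is the \<open>B_d\<close> condition; the decreasing term is controlled by the \<open>A_d\<close> condition
  if the product is not limited by \<open>Y\<close>, and by the \<open>C_d\<close> condition if it is.
\<close>

section \<open>The Weyl--van der Corput inequality\<close>

lemma e_add: "e (x + y) = e x * e y"
  by (simp add: e_def distrib_left exp_add)

lemma e_cis: "e x = cis (2 * pi * x)"
  by (simp add: e_def cis_conv_exp mult_ac)

lemma norm_e [simp]: "norm (e x) = 1"
  by (simp add: e_cis)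

lemma e_diff: "e (x - y) = e x * cnj (e y)"
  by (simp add: e_cis cis_cnj cis_mult right_diff_distrib)

lemma e_of_int [simp]: "e (of_int k) = 1"
  using cos_int_2pin[of k] sin_int_2pin[of k]
  by (simp add: e_cis complex_eq_iff)
 
definition esum :: "(nat \<Rightarrow> real) \<Rightarrow> nat \<Rightarrow> complex" where
  "esum F N = (\<Sum>n<N. e (F n))"

lemma norm_esum_le: "norm (esum F N) \<le> real N"
  unfolding esum_def by (rule order_trans[OF norm_sum]) simp

definition shift_diff :: "nat \<Rightarrow> (nat \<Rightarrow> real) \<Rightarrow> nat \<Rightarrow> real" where
  "shift_diff h F = (\<lambda>n. F (n + h) - F n)"

text \<open>Extension by zero to the integers, so that every shift by \<open>j < H\<close> is summed
  over the same range of length \<open>N + H - 1\<close> and sums can be interchanged without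
  boundary cases.\<close>

definition zext :: "(nat \<Rightarrow> complex) \<Rightarrow> nat \<Rightarrow> int \<Rightarrow> complex" where
  "zext z N i = (if 0 \<le> i \<and> i < int N then z (nat i) else 0)"

lemma sum_zext_shift:
  assumes "j < H"
  shows "(\<Sum>m<N+H-1. zext z N (int m - int j)) = (\<Sum>n<N. z n)"
proof -
  have "(\<Sum>m<N+H-1. zext z N (int m - int j)) = (\<Sum>m\<in>(\<lambda>n. n + j) ` {..<N}. zext z N (int m - int j))"
  proof (intro sum.mono_neutral_right ballI)
    show "(\<lambda>n. n + j) ` {..<N} \<subseteq> {..<N+H-1}" using assms by auto
  next
    fix m assume m: "m \<in> {..<N+H-1} - (\<lambda>n. n + j) ` {..<N}"
    have "\<not> (j \<le> m \<and> m - j < N)"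
    proof
      assume "j \<le> m \<and> m - j < N"
      hence "m \<in> (\<lambda>n. n + j) ` {..<N}" by (intro image_eqI[of _ _ "m - j"]) auto
      thus False using m by simp
    qed
    thus "zext z N (int m - int j) = 0" by (auto simp: zext_def)
  qed simp
  also have "\<dots> = (\<Sum>n<N. z n)"
    by (subst sum.reindex) (auto simp: zext_def intro!: sum.cong)
  finally show ?thesis .
qed

text \<open>Both factors can be nonzero only for \<open>k <= m < N + j\<close>; the substitution
  \<open>m = n + k\<close> turns this range into \<open>n < N - (k - j)\<close>. Truncated
  subtraction gives the empty sum when the lag exceeds \<open>N\<close>.\<close>

lemma sum_zext_corr:
  assumes "j \<le> k" "k < H"
  shows "(\<Sum>m<N+H-1. zext z N (int m - int j) * cnj (zext z N (int m - int k)))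
       = (\<Sum>n<N-(k-j). z (n + (k-j)) * cnj (z n))"
proof -
  have "(\<Sum>m<N+H-1. zext z N (int m - int j) * cnj (zext z N (int m - int k)))
     = (\<Sum>m\<in>(\<lambda>n. n + k) ` {..<N-(k-j)}. zext z N (int m - int j) * cnj (zext z N (int m - int k)))"
  proof (intro sum.mono_neutral_right ballI)
    show "(\<lambda>n. n + k) ` {..<N-(k-j)} \<subseteq> {..<N+H-1}" using assms by auto
  next
    fix m assume m: "m \<in> {..<N+H-1} - (\<lambda>n. n + k) ` {..<N-(k-j)}"
    have "\<not> (k \<le> m \<and> m - k < N - (k - j))"
    proof
      assume "k \<le> m \<and> m - k < N - (k - j)"
      hence "m \<in> (\<lambda>n. n + k) ` {..<N-(k-j)}" by (intro image_eqI[of _ _ "m - k"]) auto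
      thus False using m by simp
    qed
    hence "int m - int k < 0 \<or> int m - int j \<ge> int N" using assms by linarith
    thus "zext z N (int m - int j) * cnj (zext z N (int m - int k)) = 0"
      by (auto simp: zext_def)
  qed simp
  also have "\<dots> = (\<Sum>n<N-(k-j). z (n + (k-j)) * cnj (z n))"
  proof (subst sum.reindex; (rule sum.cong)?; simp?)
    fix n assume n: "n < N - (k - j)"
    have "nat (int n + int k - int j) = n + (k - j)" using assms by auto
    thus "zext z N (int n + int k - int j) * cnj (zext z N (int n)) = z (n + (k-j)) * cnj (z n)"
      using n assms by (auto simp: zext_def)
  qed
  finally show ?thesis .
qed

text \<open>Among the pairs, the distance 0 occurs \<open>H\<close> times and each positive
  \<open>h\<close> occurs \<open>2 * (H - h)\<close> times. The induction adds one row, one column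
  and a corner to the square.\<close>

lemma sum_abs_diff:
  fixes c :: "nat \<Rightarrow> real"
  shows "(\<Sum>j<H. \<Sum>k<H. c (if j \<le> k then k - j else j - k))
     = real H * c 0 + 2 * (\<Sum>h=1..<H. (real H - real h) * c h)"
proof (induction H)
  case 0 show ?case by simp
next
  case (Suc H)
  let ?d = "\<lambda>j k. c (if j \<le> k then k - j else j - k)"
  have "(\<Sum>j<Suc H. \<Sum>k<Suc H. ?d j k)
      = (\<Sum>j<H. \<Sum>k<H. ?d j k) + (\<Sum>j<H. ?d j H) + ((\<Sum>k<H. ?d H k) + c 0)"
    by (simp add: sum.distrib)
  moreover have "(\<Sum>j<H. ?d j H) = (\<Sum>j<H. c (H - j))" by (intro sum.cong) auto
  moreover have "(\<Sum>k<H. ?d H k) = (\<Sum>j<H. c (H - j))" by (intro sum.cong) auto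
  moreover have "(\<Sum>j<H. c (H - j)) = (\<Sum>h=1..<Suc H. c h)"
    by (rule sum.reindex_bij_witness[of _ "\<lambda>h. H - h" "\<lambda>h. H - h"]) auto
  moreover have "(\<Sum>h=1..<Suc H. (real (Suc H) - real h) * c h)
      = (\<Sum>h=1..<H. (real H - real h) * c h) + (\<Sum>h=1..<Suc H. c h)"
  proof -
    have "(\<Sum>h=1..<Suc H. (real (Suc H) - real h) * c h)
       = (\<Sum>h=1..<Suc H. (real H - real h) * c h) + (\<Sum>h=1..<Suc H. c h)"
      unfolding sum.distrib[symmetric] by (intro sum.cong) (auto simp: algebra_simps)
    also have "(\<Sum>h=1..<Suc H. (real H - real h) * c h) = (\<Sum>h=1..<H. (real H - real h) * c h)"
      by (cases "H = 0") auto
    finally show ?thesis .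
  qed
  ultimately show ?case using Suc by (simp add: algebra_simps)
qed

lemma sum_power2_le_card:
  fixes x :: "'a \<Rightarrow> real"
  shows "(\<Sum>i\<in>I. x i)\<^sup>2 \<le> real (card I) * (\<Sum>i\<in>I. (x i)\<^sup>2)"
  using Cauchy_Schwarz_ineq_sum[of "\<lambda>_. 1" x I] by simp

text \<open>Averaging over \<open>H\<close> shifts writes \<open>H\<close> times the sum as a sum of
  \<open>N + H - 1\<close> window sums \<open>a m\<close>. Cauchy-Schwarz over \<open>m\<close> and
  expansion of the squares leave the correlations of \<open>z\<close>.\<close>

lemma van_der_corput_inequality:
  fixes z :: "nat \<Rightarrow> complex" and N H :: nat
  assumes H: "H \<ge> 1"
  defines "c \<equiv> \<lambda>h. norm (\<Sum>n<N-h. z (n + h) * cnj (z n))"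
  shows "(real H)\<^sup>2 * (norm (\<Sum>n<N. z n))\<^sup>2
     \<le> real (N + H - 1) * (real H * c 0 + 2 * (\<Sum>h=1..<H. (real H - real h) * c h))"
proof -
  define a where "a m = (\<Sum>j<H. zext z N (int m - int j))" for m :: nat
  have "(\<Sum>j<H. \<Sum>m<N+H-1. zext z N (int m - int j)) = (\<Sum>j<H. \<Sum>n<N. z n)"
    by (intro sum.cong refl sum_zext_shift) simp
  hence "of_nat H * (\<Sum>n<N. z n) = (\<Sum>j<H. \<Sum>m<N+H-1. zext z N (int m - int j))"
    by simp
  also have "\<dots> = (\<Sum>m<N+H-1. a m)"
    unfolding a_def by (rule sum.swap)
  finally have S: "of_nat H * (\<Sum>n<N. z n) = (\<Sum>m<N+H-1. a m)" .
  have "real H * norm (\<Sum>n<N. z n) = norm (\<Sum>m<N+H-1. a m)"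
    unfolding S[symmetric] by (simp add: norm_mult)
  also have "\<dots> \<le> (\<Sum>m<N+H-1. norm (a m))" by (rule norm_sum)
  finally have "(real H * norm (\<Sum>n<N. z n))\<^sup>2 \<le> (\<Sum>m<N+H-1. norm (a m))\<^sup>2"
    by (intro power_mono) auto
  also have "\<dots> \<le> real (N+H-1) * (\<Sum>m<N+H-1. (norm (a m))\<^sup>2)"
    using sum_power2_le_card[of "\<lambda>m. norm (a m)" "{..<N+H-1}"] by simp
  also have "(\<Sum>m<N+H-1. (norm (a m))\<^sup>2) \<le> (\<Sum>j<H. \<Sum>k<H. c (if j \<le> k then k - j else j - k))"
  proof -
    let ?t = "\<lambda>j k m. zext z N (int m - int j) * cnj (zext z N (int m - int k))"
    have "complex_of_real (\<Sum>m<N+H-1. (norm (a m))\<^sup>2) = (\<Sum>m<N+H-1. a m * cnj (a m))"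
      by (simp add: complex_norm_square del: of_real_power)
    also have "\<dots> = (\<Sum>m<N+H-1. \<Sum>j<H. \<Sum>k<H. ?t j k m)"
      by (simp add: a_def sum_product)
    also have "\<dots> = (\<Sum>j<H. \<Sum>m<N+H-1. \<Sum>k<H. ?t j k m)" by (rule sum.swap)
    also have "\<dots> = (\<Sum>j<H. \<Sum>k<H. \<Sum>m<N+H-1. ?t j k m)"
      by (intro sum.cong refl sum.swap)
    finally have "norm (complex_of_real (\<Sum>m<N+H-1. (norm (a m))\<^sup>2)) = norm (\<Sum>j<H. \<Sum>k<H. \<Sum>m<N+H-1. ?t j k m)"
      by (rule arg_cong)
    hence "(\<Sum>m<N+H-1. (norm (a m))\<^sup>2) = norm (\<Sum>j<H. \<Sum>k<H. \<Sum>m<N+H-1. ?t j k m)"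
      unfolding norm_of_real by (subst (asm) abs_of_nonneg) (auto intro: sum_nonneg)
    also have "\<dots> \<le> (\<Sum>j<H. \<Sum>k<H. norm (\<Sum>m<N+H-1. ?t j k m))"
      by (intro order_trans[OF norm_sum] sum_mono norm_sum)
    also have "\<dots> = (\<Sum>j<H. \<Sum>k<H. c (if j \<le> k then k - j else j - k))"
    proof (intro sum.cong refl)
      fix j k assume jk: "j \<in> {..<H}" "k \<in> {..<H}"
      show "norm (\<Sum>m<N+H-1. ?t j k m) = c (if j \<le> k then k - j else j - k)"
      proof (cases "j \<le> k")
        case True
        thus ?thesis using jk by (subst sum_zext_corr) (auto simp: c_def)
      next
        case False
        \<comment> \<open>Exchanging \<open>j\<close> and \<open>k\<close> conjugates the
          correlation, so its norm depends only on their distance.\<close>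
        have "norm (\<Sum>m<N+H-1. ?t j k m) = norm (cnj (\<Sum>m<N+H-1. ?t j k m))" by (rule complex_mod_cnj[symmetric])
        also have "cnj (\<Sum>m<N+H-1. ?t j k m) = (\<Sum>m<N+H-1. ?t k j m)"
          by (simp add: mult.commute)
        also have "norm \<dots> = c (j - k)"
          using jk False by (subst sum_zext_corr) (auto simp: c_def)
        finally show ?thesis using False by simp
      qed
    qed
    finally show ?thesis .
  qed
  finally show ?thesis unfolding sum_abs_diff
    by (simp add: power_mult_distrib mult_left_mono)
qed

lemma esum_van_der_corput:
  assumes "H \<ge> 1"
  shows "(real H)\<^sup>2 * (norm (esum F N))\<^sup>2
    \<le> real (N + H - 1) * (real H * real N
        + 2 * (\<Sum>h=1..<H. (real H - real h) * norm (esum (shift_diff h F) (N - h))))"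
proof -
  have *: "(\<Sum>n<N-h. e (F (n + h)) * cnj (e (F n))) = esum (shift_diff h F) (N - h)" for h
    by (simp add: esum_def shift_diff_def e_diff)
  have "norm (esum (shift_diff 0 F) N) = real N"
    by (simp add: esum_def shift_diff_def e_of_int[of 0, simplified])
  thus ?thesis
    using van_der_corput_inequality[OF assms, of "\<lambda>n. e (F n)" N]
    unfolding * by (simp add: esum_def)
qed

section \<open>The Kuzmin--Landau inequality\<close>

lemma sin_ge_mult_cos:
  fixes x :: real
  assumes "0 \<le> x" "x \<le> pi"
  shows "x * cos x \<le> sin x"
proof -
  have "sin 0 - 0 * cos 0 \<le> sin x - x * cos x"
  proof (rule DERIV_nonneg_imp_nondecreasing[OF assms(1)])
    fix y assume y: "0 \<le> y" "y \<le> x"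
    have "((\<lambda>x. sin x - x * cos x) has_real_derivative y * sin y) (at y)"
      by (auto intro!: derivative_eq_intros)
    moreover have "y * sin y \<ge> 0" using y assms by (intro mult_nonneg_nonneg sin_ge_zero) auto
    ultimately show "\<exists>z. ((\<lambda>x. sin x - x * cos x) has_real_derivative z) (at y) \<and> 0 \<le> z" by blast
  qed
  thus ?thesis by simp
qed

text \<open>The left side equals \<open>cot (a / 2)\<close>, and \<open>cot u <= 1 / u\<close>
  because \<open>u * cos u <= sin u\<close>.\<close>

lemma cot_half_bound:
  fixes a :: real
  assumes "0 < a" "a < pi"
  shows "1 / sin a + cot a \<le> 2 / a"
proof -
  have s: "sin (a/2) > 0" "cos (a/2) > 0" using assms by (auto intro!: sin_gt_zero cos_gt_zero)
  have sa: "sin a = 2 * sin (a/2) * cos (a/2)" using sin_double[of "a/2"] by simp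
  have ca: "1 + cos a = 2 * (cos (a/2))\<^sup>2" using cos_double_cos[of "a/2"] by simp
  have "1 / sin a + cot a = (1 + cos a) / sin a" by (simp add: cot_def add_divide_distrib)
  also have "\<dots> = cos (a/2) / sin (a/2)"
    unfolding sa ca using s by (simp add: power2_eq_square)
  also have "\<dots> \<le> 2 / a"
    using sin_ge_mult_cos[of "a/2"] assms s by (simp add: field_simps)
  finally show ?thesis .
qed

lemma cot_decreasing:
  fixes a b :: real
  assumes "0 < a" "a \<le> b" "b < pi"
  shows "cot b \<le> cot a"
proof -
  have s: "sin a > 0" "sin b > 0" using assms by (auto intro!: sin_gt_zero)
  have "cot a - cot b = sin (b - a) / (sin a * sin b)"
    using s by (simp add: cot_def sin_diff field_simps)
  moreover have "sin (b - a) \<ge> 0" using assms by (intro sin_ge_zero) auto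
  ultimately have "cot a - cot b \<ge> 0" using s by simp
  thus ?thesis by simp
qed

text \<open>\<open>kl_coeff (pi * g)\<close> is \<open>1 / (1 - e g)\<close>, written so that its variation in \<open>g\<close> telescopes.\<close>
definition kl_coeff :: "real \<Rightarrow> complex" where
  "kl_coeff a = Complex (1/2) (cot a / 2)"

lemma norm_kl_coeff:
  assumes "0 < a" "a < pi"
  shows "norm (kl_coeff a) = 1 / (2 * sin a)"
proof -
  have s: "sin a > 0" using assms by (intro sin_gt_zero)
  have "(1/2)\<^sup>2 + (cot a / 2)\<^sup>2 = (1 / (2 * sin a))\<^sup>2"
    using s sin_cos_squared_add[of a]
    by (simp add: cot_def power2_eq_square field_simps)
  thus ?thesis using s by (simp add: kl_coeff_def cmod_def real_sqrt_unique)
qed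

lemma norm_kl_coeff_diff: "norm (kl_coeff a - kl_coeff b) = \<bar>cot a - cot b\<bar> / 2"
  by (simp add: kl_coeff_def cmod_def diff_divide_distrib[symmetric] real_sqrt_abs)

lemma kl_coeff_mult:
  assumes "sin (pi * g) \<noteq> 0"
  shows "kl_coeff (pi * g) * (1 - e g) = 1"
proof -
  have e: "e g = Complex (1 - 2 * (sin (pi * g))\<^sup>2) (2 * sin (pi * g) * cos (pi * g))"
    using cos_double_sin[of "pi * g"] sin_double[of "pi * g"]
    by (simp add: e_cis complex_eq_iff mult.assoc)
  have "2 * (cos (pi * g) * cos (pi * g)) + 2 * (sin (pi * g) * sin (pi * g)) = 2"
    using sin_cos_squared_add3[of "pi * g"] unfolding distrib_left[symmetric] by (simp only: mult_1_right)
  thus ?thesis using assms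
    by (simp add: kl_coeff_def e complex_eq_iff cot_def power2_eq_square field_simps)
qed

text \<open>By \<open>kl_coeff_mult\<close>,
  \<open>e (F n) = (e (F n) - e (F (Suc n))) * C n\<close>; Abel summation moves the differences
  onto \<open>C\<close>.\<close>

lemma esum_by_parts:
  assumes "\<And>n. n \<le> M \<Longrightarrow> sin (pi * (F (Suc n) - F n)) \<noteq> 0"
  defines "C \<equiv> \<lambda>n. kl_coeff (pi * (F (Suc n) - F n))"
  shows "esum F (Suc M) = e (F 0) * C 0 + (\<Sum>n<M. e (F (Suc n)) * (C (Suc n) - C n)) - e (F (Suc M)) * C M"
proof -
  have *: "e (F n) = (e (F n) - e (F (Suc n))) * C n" if "n \<le> M" for n
  proof -
    have "e (F (Suc n)) = e (F n) * e (F (Suc n) - F n)" by (simp add: e_add[symmetric])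
    hence "(e (F n) - e (F (Suc n))) * C n = e (F n) * (C n * (1 - e (F (Suc n) - F n)))"
      by (simp add: algebra_simps)
    thus ?thesis using kl_coeff_mult[OF assms(1)[OF that]] by (simp add: C_def)
  qed
  have "esum F (Suc m) = e (F 0) * C 0 + (\<Sum>n<m. e (F (Suc n)) * (C (Suc n) - C n)) - e (F (Suc m)) * C m"
    if "m \<le> M" for m
    using that
  proof (induction m)
    case 0
    show ?case using *[of 0] by (simp add: esum_def algebra_simps)
  next
    case (Suc m)
    have "esum F (Suc (Suc m)) = esum F (Suc m) + e (F (Suc m))" by (simp add: esum_def)
    also have "e (F (Suc m)) = (e (F (Suc m)) - e (F (Suc (Suc m)))) * C (Suc m)"
      using *[of "Suc m"] Suc by simp
    finally show ?case using Suc by (simp add: algebra_simps)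
  qed
  thus ?thesis by simp
qed

lemma esum_shift_int: "esum (\<lambda>n. F n - of_int k * real n) N = esum F N"
proof -
  have "e (F n - of_int k * real n) = e (F n)" for n
    using e_diff[of "F n" "of_int (k * int n)"] e_of_int[of "k * int n"] by simp
  thus ?thesis by (simp add: esum_def)
qed

text \<open>Monotone increments make the cotangents decrease, so the norms of the coefficient
  differences telescope and only the two ends remain. The bound at \<open>n = M - 1\<close> involves
  \<open>F M\<close>, one index past the summed range.\<close>

lemma kuzmin_landau_unit_interval:
  assumes th: "\<theta> > 0"
    and g: "\<And>n. n < M \<Longrightarrow> \<theta> \<le> F (Suc n) - F n \<and> F (Suc n) - F n \<le> 1 - \<theta>"
    and mono: "\<And>n. F (Suc n) - F n \<le> F (Suc (Suc n)) - F (Suc n)"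
  shows "norm (esum F M) \<le> 2 / (pi * \<theta>)"
proof (cases M)
  case 0
  thus ?thesis using th by (simp add: esum_def)
next
  case (Suc m)
  define a where "a n = pi * (F (Suc n) - F n)" for n
  have a: "pi * \<theta> \<le> a n \<and> a n \<le> pi - pi * \<theta>" if "n \<le> m" for n
    using g[of n] that Suc mult_left_mono[of \<theta> "F (Suc n) - F n" pi]
      mult_left_mono[of "F (Suc n) - F n" "1 - \<theta>" pi]
    by (simp add: a_def algebra_simps)
  have pt: "pi * \<theta> > 0" using th by simp
  have a': "0 < a n \<and> a n < pi" if "n \<le> m" for n using a[OF that] pt by linarith
  have s: "sin (a n) > 0" if "n \<le> m" for n using a'[OF that] by (intro sin_gt_zero) auto
  have am: "a n \<le> a (Suc n)" for n using mono by (simp add: a_def)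
  have "esum F M = e (F 0) * kl_coeff (a 0) + (\<Sum>n<m. e (F (Suc n)) * (kl_coeff (a (Suc n)) - kl_coeff (a n)))
      - e (F (Suc m)) * kl_coeff (a m)"
    unfolding Suc a_def using s by (intro esum_by_parts) (force simp: a_def)
  also have "norm \<dots> \<le> norm (kl_coeff (a 0)) + (\<Sum>n<m. norm (kl_coeff (a (Suc n)) - kl_coeff (a n)))
       + norm (kl_coeff (a m))"
    by (intro order_trans[OF norm_triangle_ineq4] add_mono order_trans[OF norm_triangle_ineq]
        order_trans[OF norm_sum]) (auto simp: norm_mult)
  also have "(\<Sum>n<m. norm (kl_coeff (a (Suc n)) - kl_coeff (a n))) = (\<Sum>n<m. cot (a n) / 2 - cot (a (Suc n)) / 2)"
  proof (intro sum.cong refl)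
    fix n assume "n \<in> {..<m}"
    hence "cot (a (Suc n)) \<le> cot (a n)" using a'[of n] a'[of "Suc n"] am[of n] by (intro cot_decreasing) auto
    thus "norm (kl_coeff (a (Suc n)) - kl_coeff (a n)) = cot (a n) / 2 - cot (a (Suc n)) / 2"
      by (simp add: norm_kl_coeff_diff)
  qed
  also have "\<dots> = cot (a 0) / 2 - cot (a m) / 2"
    by (rule sum_lessThan_telescope')
  also have "norm (kl_coeff (a 0)) = (1 / sin (a 0)) / 2" using a'[of 0] by (simp add: norm_kl_coeff)
  also have "norm (kl_coeff (a m)) = (1 / sin (a m)) / 2" using a'[of m] by (simp add: norm_kl_coeff)
  \<comment> \<open>Replacing \<open>a m\<close> by \<open>pi - a m\<close> keeps the sine and
    negates the cotangent, so both ends take the form bounded in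
    \<open>cot_half_bound\<close>.\<close>
  also have "1 / sin (a 0) / 2 + (cot (a 0) / 2 - cot (a m) / 2) + 1 / sin (a m) / 2
     = (1 / sin (a 0) + cot (a 0)) / 2 + (1 / sin (pi - a m) + cot (pi - a m)) / 2"
    by (simp add: cot_def add_divide_distrib diff_divide_distrib mult.commute)
  also have "\<dots> \<le> (2 / a 0) / 2 + (2 / (pi - a m)) / 2"
    using a'[of 0] a'[of m] by (intro add_mono divide_right_mono cot_half_bound) auto
  also have "\<dots> \<le> (2 / (pi * \<theta>)) / 2 + (2 / (pi * \<theta>)) / 2"
    using a[of 0] a[of m] a'[of m] pt by (intro add_mono divide_right_mono divide_left_mono) auto
  finally show ?thesis by simp
qed

text \<open>Subtracting \<open>k * n\<close> from \<open>F n\<close> lowers each increment by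
  \<open>k\<close> and leaves every \<open>e (F n)\<close> unchanged.\<close>

lemma kuzmin_landau:
  fixes k :: int
  assumes th: "\<theta> > 0"
    and g: "\<And>n. n < M \<Longrightarrow> of_int k + \<theta> \<le> F (Suc n) - F n \<and> F (Suc n) - F n \<le> of_int k + 1 - \<theta>"
    and mono: "\<And>n. F (Suc n) - F n \<le> F (Suc (Suc n)) - F (Suc n)"
  shows "norm (esum F M) \<le> 2 / (pi * \<theta>)"
proof -
  have "norm (esum (\<lambda>n. F n - of_int k * real n) M) \<le> 2 / (pi * \<theta>)"
    by (rule kuzmin_landau_unit_interval[OF th]) (use g mono in \<open>force simp: algebra_simps\<close>)+
  thus ?thesis by (simp only: esum_shift_int)
qed

text \<open>The set is the difference of two sublevel sets of a monotone sequence, and each of these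
  is an initial segment.\<close>

lemma mono_sublevel_eq_atLeastLessThan:
  fixes g :: "nat \<Rightarrow> real"
  assumes "mono g"
  shows "\<exists>i j. {n. n < N \<and> \<alpha> \<le> g n \<and> g n < \<beta>} = {i..<j}"
proof -
  have *: "\<exists>j. {n. n < N \<and> g n < c} = {..<j}" for c
  proof (induction N)
    case 0 show ?case by (intro exI[of _ 0]) auto
  next
    case (Suc N)
    then obtain j where j: "{n. n < N \<and> g n < c} = {..<j}" by blast
    show ?case
    proof (cases "g N < c")
      case True
      hence "g n < c" if "n \<le> N" for n using monoD[OF assms that] by linarith
      hence "{n. n < Suc N \<and> g n < c} = {..<Suc N}" by auto
      thus ?thesis by blast
    next
      case False
      hence "{n. n < Suc N \<and> g n < c} = {n. n < N \<and> g n < c}" by (auto simp: less_Suc_eq)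
      thus ?thesis using j by blast
    qed
  qed
  obtain i j where ij: "{n. n < N \<and> g n < \<alpha>} = {..<i}" "{n. n < N \<and> g n < \<beta>} = {..<j}"
    using * by metis
  have "{n. n < N \<and> \<alpha> \<le> g n \<and> g n < \<beta>} = {n. n < N \<and> g n < \<beta>} - {n. n < N \<and> g n < \<alpha>}"
    by auto
  also have "\<dots> = {i..<j}" unfolding ij by auto
  finally show ?thesis by blast
qed

section \<open>The second derivative test\<close>

text \<open>The values at the first and last counted indices, \<open>i\<close> and
  \<open>j - 1\<close>, are at least \<open>lam * (j - 1 - i)\<close> apart, yet both lie in an
  interval of length \<open>\<beta> - \<alpha>\<close>.\<close>

lemma card_separated:
  fixes g :: "nat \<Rightarrow> real"
  assumes l: "lam > 0" and g: "\<And>n. lam \<le> g (Suc n) - g n" and ab: "\<alpha> \<le> \<beta>"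
  shows "real (card {n. n < N \<and> \<alpha> \<le> g n \<and> g n < \<beta>}) \<le> (\<beta> - \<alpha>) / lam + 1"
proof -
  have "g n \<le> g (Suc n)" for n using g[of n] l by linarith
  hence "mono g" by (rule incseq_SucI)
  then obtain i j where ij: "{n. n < N \<and> \<alpha> \<le> g n \<and> g n < \<beta>} = {i..<j}"
    using mono_sublevel_eq_atLeastLessThan by blast
  have sep: "lam * real k \<le> g (n + k) - g n" for n k
  proof (induction k)
    case (Suc k)
    thus ?case using g[of "n + k"] by (simp add: algebra_simps)
  qed simp
  show ?thesis
  proof (cases "i < j")
    case False
    thus ?thesis using ab l by (simp add: ij)
  next
    case True
    hence "i \<in> {n. n < N \<and> \<alpha> \<le> g n \<and> g n < \<beta>}" "j - 1 \<in> {n. n < N \<and> \<alpha> \<le> g n \<and> g n < \<beta>}"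
      unfolding ij by auto
    moreover have "lam * real (j - 1 - i) \<le> g (j - 1) - g i"
      using sep[of "j - 1 - i" i] True by simp
    ultimately have "lam * real (j - 1 - i) \<le> \<beta> - \<alpha>" by simp
    hence "real (j - 1 - i) \<le> (\<beta> - \<alpha>) / lam" using l by (simp add: field_simps)
    moreover have "real (j - i) = real (j - 1 - i) + 1" using True by simp
    ultimately show ?thesis by (simp add: ij)
  qed
qed

lemma sum_atLeastLessThan_e: "(\<Sum>n=i..<j. e (F n)) = esum (\<lambda>n. F (n + i)) (j - i)"
  using sum.atLeastLessThan_shift_0[of "\<lambda>n. e (F n)" i j]
  by (simp add: esum_def atLeast0LessThan add.commute)

text \<open>One unit period of the increment \<open>g\<close>: the terms with \<open>g n\<close>
  near the integer \<open>k\<close> are counted trivially by \<open>card_separated\<close>; those at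
  distance at least \<open>\<theta>\<close> from the integers form a block to which Kuzmin--Landau
  applies.\<close>

lemma norm_sum_period_le:
  fixes F :: "nat \<Rightarrow> real"
  defines "g \<equiv> \<lambda>n. F (Suc n) - F n"
  assumes l: "lam > 0" and g: "\<And>n. lam \<le> g (Suc n) - g n" and th: "\<theta> > 0" "\<theta> \<le> 1/2"
  shows "norm (\<Sum>n\<in>{n \<in> {..<N}. \<lfloor>g n + \<theta>\<rfloor> = k}. e (F n)) \<le> 2 * \<theta> / lam + 1 + 2 / (pi * \<theta>)"
proof -
  let ?P = "{n. n < N \<and> of_int k - \<theta> \<le> g n \<and> g n < of_int k + \<theta>}"
  let ?R = "{n. n < N \<and> of_int k + \<theta> \<le> g n \<and> g n < of_int k + 1 - \<theta>}"
  have gm: "g n \<le> g (Suc n)" for n using g[of n] l by linarith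
  hence "mono g" by (rule incseq_SucI)
  then obtain i j where ij: "?R = {i..<j}"
    using mono_sublevel_eq_atLeastLessThan by blast
  have "{n \<in> {..<N}. \<lfloor>g n + \<theta>\<rfloor> = k} = ?P \<union> ?R"
    using th by (auto simp: floor_eq_iff)
  hence "(\<Sum>n\<in>{n \<in> {..<N}. \<lfloor>g n + \<theta>\<rfloor> = k}. e (F n)) = (\<Sum>n\<in>?P. e (F n)) + (\<Sum>n\<in>?R. e (F n))"
    by (simp add: sum.union_disjoint disjoint_iff)
  hence "norm (\<Sum>n\<in>{n \<in> {..<N}. \<lfloor>g n + \<theta>\<rfloor> = k}. e (F n))
      \<le> norm (\<Sum>n\<in>?P. e (F n)) + norm (\<Sum>n\<in>?R. e (F n))"
    by (simp only: norm_triangle_ineq)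
  moreover have "norm (\<Sum>n\<in>?P. e (F n)) \<le> real (card ?P)"
    by (rule order_trans[OF norm_sum]) simp
  moreover have "real (card ?P) \<le> ((of_int k + \<theta>) - (of_int k - \<theta>)) / lam + 1"
    by (rule card_separated) (use l g th in simp_all)
  moreover have "norm (\<Sum>n\<in>?R. e (F n)) \<le> 2 / (pi * \<theta>)"
    unfolding ij sum_atLeastLessThan_e
  proof (rule kuzmin_landau[where k = k, OF th(1)])
    fix n assume "n < j - i"
    hence "n + i \<in> ?R" unfolding ij by auto
    thus "of_int k + \<theta> \<le> F (Suc n + i) - F (n + i) \<and> F (Suc n + i) - F (n + i) \<le> of_int k + 1 - \<theta>"
      by (simp add: g_def)
  next
    fix n
    show "F (Suc n + i) - F (n + i) \<le> F (Suc (Suc n) + i) - F (Suc n + i)"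
      using gm[of "n + i"] by (simp add: g_def)
  qed
  ultimately show ?thesis by simp
qed

text \<open>\<open>constA\<close> is the positive root of this quadratic equation. It serves to show
  that \<open>4 / sqrt pi + sqrt lam\<close>, the numerator of the optimised bound for one period,
  is at most \<open>constA\<close>.\<close>

lemma constA_eq: "constA\<^sup>2 = 4 / sqrt pi * constA + 3/2"
proof -
  define s where "s = sqrt (1 + 3 * pi / 8)"
  define p where "p = sqrt pi"
  have p: "p > 0" "pi = p\<^sup>2" by (auto simp: p_def)
  have "s\<^sup>2 = 1 + 3 * p\<^sup>2 / 8" by (simp add: s_def p_def add_nonneg_nonneg)
  moreover have "constA * p = 2 * (1 + s)" using p by (simp add: constA_def s_def p_def)
  ultimately have "(constA * p)\<^sup>2 = 4 * (constA * p) + 3/2 * p\<^sup>2"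
    by (simp add: power2_eq_square algebra_simps)
  moreover have "(4 / p * constA + 3/2) * p\<^sup>2 = 4 * (constA * p) + 3/2 * p\<^sup>2"
    using p(1) by (simp add: power2_eq_square distrib_right)
  ultimately have "constA\<^sup>2 * p\<^sup>2 = (4 / p * constA + 3/2) * p\<^sup>2"
    by (simp only: power_mult_distrib)
  thus ?thesis using p(1) unfolding p_def[symmetric] by (simp only: mult_cancel_right) simp
qed

lemma constA_bounds: "2.5 \<le> constA" "constA \<le> 2.8"
proof -
  have pi: "3.1415 < pi" "pi < 3.1416" using pi_approx by auto
  have sp: "1.772 \<le> sqrt pi" "sqrt pi \<le> 1.7726"
    by (rule real_le_rsqrt, use pi in \<open>simp add: power2_eq_square\<close>)
       (rule real_le_lsqrt; use pi in \<open>simp add: power2_eq_square\<close>)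
  have s: "1.475 \<le> sqrt (1 + 3 * pi / 8)" "sqrt (1 + 3 * pi / 8) \<le> 1.4762"
    by (rule real_le_rsqrt, use pi in \<open>simp add: power2_eq_square\<close>)
       (rule real_le_lsqrt; use pi in \<open>simp add: power2_eq_square\<close>)
  have *: "constA = 2 * (1 + sqrt (1 + 3 * pi / 8)) / sqrt pi" by (simp add: constA_def)
  show "2.5 \<le> constA" unfolding * using sp s by (simp add: field_simps)
  show "constA \<le> 2.8" unfolding * using sp s by (simp add: field_simps)
qed

lemma constB_bounds: "4.82 \<le> constB" "constB \<le> 4.83"
proof -
  have "1.414 \<le> sqrt 2" by (rule real_le_rsqrt) (simp add: power2_eq_square)
  thus "4.82 \<le> constB" by (simp add: constB_def)
  have "sqrt 2 \<le> 1.415" by (rule real_le_lsqrt) (simp_all add: power2_eq_square)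
  thus "constB \<le> 4.83" by (simp add: constB_def)
qed

text \<open>The increments grow by at most \<open>Lam * Y\<close> in total, so they meet at most
  \<open>Lam * Y + 2\<close> periods, each contributing at most \<open>constA / sqrt lam\<close>. If
  \<open>lam\<close> is too large for this, the trivial bound \<open>N\<close> suffices.\<close>

lemma second_difference_test_everywhere:
  fixes F :: "nat \<Rightarrow> real"
  assumes l: "lam > 0" and Y: "Y \<ge> 1" and N: "real N \<le> Y + 1"
    and F: "\<And>n. lam \<le> (F (n + 2) - F (n + 1)) - (F (n + 1) - F n) \<and> (F (n + 2) - F (n + 1)) - (F (n + 1) - F n) \<le> Lam"
  shows "norm (esum F N) \<le> constA * (Lam * Y + 2) / sqrt lam"
proof (cases "N = 0")
  case True
  have "Lam > 0" using F[of 0] l by linarith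
  thus ?thesis using True Y l constA_bounds by (simp add: esum_def)
next
  case N0: False
  have lL: "lam \<le> Lam" using F[of 0] by linarith
  have sl: "sqrt lam > 0" "(sqrt lam)\<^sup>2 = lam" using l by auto
  define g where "g n = F (Suc n) - F n" for n
  have g: "lam \<le> g (Suc n) - g n" "g (Suc n) - g n \<le> Lam" for n
    using F[of n] by (simp_all add: g_def)
  show ?thesis
  proof (cases "constA * sqrt lam \<le> 1")
    case False
    define x where "x = constA * sqrt lam"
    have x: "x > 1" using False by (simp add: x_def)
    \<comment> \<open>For \<open>x >= 2\<close> the first term is already at least
      \<open>Y + 1\<close>; for \<open>x < 2\<close> the second is at least 1, which covers the
      excess of \<open>N\<close> over \<open>Y\<close>.\<close>
    have "real N \<le> x * Y + 2 * (constA\<^sup>2 / x)"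
    proof (cases "x \<ge> 2")
      case True
      hence "2 * Y \<le> x * Y" using Y by (intro mult_right_mono) auto
      moreover have "constA\<^sup>2 / x \<ge> 0" using x by simp
      ultimately show ?thesis using N Y by linarith
    next
      case False
      have "1 * Y \<le> x * Y" using x Y by (intro mult_right_mono) auto
      moreover have "constA\<^sup>2 \<ge> 1" using constA_bounds by (simp add: one_le_power)
      hence "constA\<^sup>2 / x \<ge> 1/2" using x False by (simp add: field_simps)
      ultimately show ?thesis using N by linarith
    qed
    also have "constA\<^sup>2 / x = constA / sqrt lam"
      using constA_bounds by (simp add: x_def power2_eq_square)
    also have "x * Y = constA * lam * Y / sqrt lam"
      using sl by (simp add: x_def field_simps power2_eq_square)
    also have "\<dots> \<le> constA * Lam * Y / sqrt lam"
      using lL Y constA_bounds sl by (intro divide_right_mono mult_right_mono mult_left_mono) auto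
    also have "constA * Lam * Y / sqrt lam + 2 * (constA / sqrt lam) = constA * (Lam * Y + 2) / sqrt lam"
      by (simp add: add_divide_distrib distrib_left mult_ac)
    finally show ?thesis using norm_esum_le[of F N] by linarith
  next
    case True
    \<comment> \<open>This choice minimises \<open>2 * \<theta> / lam + 2 / (pi * \<theta>)\<close>,
      making both terms equal to \<open>2 / sqrt pi / sqrt lam\<close>.\<close>
    define \<theta> where "\<theta> = sqrt lam / sqrt pi"
    have sp: "sqrt pi > 0" "(sqrt pi)\<^sup>2 = pi" "sqrt pi \<ge> 1" using pi_gt3 by auto
    have th: "\<theta> > 0" using sl sp by (simp add: \<theta>_def)
    have "sqrt lam \<le> 1/2"
    proof -
      have "2 * sqrt lam \<le> constA * sqrt lam" using constA_bounds sl by (intro mult_right_mono) auto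
      thus ?thesis using True by linarith
    qed
    hence "sqrt lam / sqrt pi \<le> 1/2 / 1" using sp sl by (intro frac_le) auto
    hence th2: "\<theta> \<le> 1/2" by (simp add: \<theta>_def)
    let ?k = "\<lambda>n. \<lfloor>g n + \<theta>\<rfloor>"
    let ?b = "2 * \<theta> / lam + 1 + 2 / (pi * \<theta>)"
    have b: "?b \<le> constA / sqrt lam"
    proof -
      have "2 * \<theta> / lam = 2 / sqrt pi / sqrt lam"
        using sl sp by (simp add: \<theta>_def field_simps power2_eq_square)
      moreover have "2 / (pi * \<theta>) = 2 / sqrt pi / sqrt lam"
        using sl sp by (simp add: \<theta>_def field_simps power2_eq_square)
      ultimately have "?b = (4 / sqrt pi + sqrt lam) / sqrt lam"
        using sl by (simp add: add_divide_distrib)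
      also have "4 / sqrt pi + sqrt lam \<le> constA"
      proof -
        have "constA * (4 / sqrt pi + sqrt lam) \<le> 4 / sqrt pi * constA + 3/2"
          using True by (simp add: distrib_left mult.commute)
        also have "\<dots> = constA * constA" using constA_eq by (simp add: power2_eq_square)
        finally show ?thesis using constA_bounds by (simp add: mult_le_cancel_left_pos)
      qed
      finally show ?thesis using sl by (simp add: divide_right_mono)
    qed
    have period: "norm (\<Sum>n\<in>{n \<in> {..<N}. ?k n = k}. e (F n)) \<le> ?b" for k
      unfolding g_def by (rule norm_sum_period_le[OF l _ th th2]) (use g(1) in \<open>simp add: g_def\<close>)
    have "esum F N = (\<Sum>k\<in>?k ` {..<N}. \<Sum>n\<in>{n \<in> {..<N}. ?k n = k}. e (F n))"
      unfolding esum_def by (rule sum.image_gen) simp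
    also have "norm \<dots> \<le> (\<Sum>k\<in>?k ` {..<N}. ?b)"
      by (intro order_trans[OF norm_sum] sum_mono period)
    also have "\<dots> = real (card (?k ` {..<N})) * ?b" by simp
    also have "\<dots> \<le> (Lam * Y + 2) * (constA / sqrt lam)"
    proof (intro mult_mono b)
      have mono: "g m \<le> g n" if "m \<le> n" for m n
      proof (rule lift_Suc_mono_le[OF _ that])
        fix n show "g n \<le> g (Suc n)" using g(1)[of n] l by linarith
      qed
      have growth: "g n \<le> g 0 + Lam * real n" for n
      proof (induction n)
        case (Suc n)
        thus ?case using g(2)[of n] by (simp add: algebra_simps)
      qed simp
      have "?k ` {..<N} \<subseteq> {?k 0..?k (N - 1)}"
        using mono N0 by (auto intro!: floor_mono)
      hence "card (?k ` {..<N}) \<le> card {?k 0..?k (N - 1)}" by (intro card_mono) auto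
      also have "\<dots> = nat (?k (N - 1) - ?k 0 + 1)" by (simp add: algebra_simps)
      finally have "real (card (?k ` {..<N})) \<le> real (nat (?k (N - 1) - ?k 0 + 1))" by simp
      also have "?k 0 \<le> ?k (N - 1)" using mono by (intro floor_mono) auto
      hence "real (nat (?k (N - 1) - ?k 0 + 1)) = of_int (?k (N - 1)) - of_int (?k 0) + 1" by simp
      also have "\<dots> \<le> g (N - 1) - g 0 + 2" by linarith
      also have "\<dots> \<le> Lam * real (N - 1) + 2" using growth[of "N - 1"] by simp
      also have "\<dots> \<le> Lam * Y + 2" using N N0 lL l by (intro add_right_mono mult_left_mono) auto
      finally show "real (card (?k ` {..<N})) \<le> Lam * Y + 2" .
    next
      show "Lam * Y + 2 \<ge> 0" using lL l Y by (simp add: add_nonneg_nonneg)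
      show "?b \<ge> 0" using th l by (simp add: add_nonneg_nonneg)
    qed
    finally show ?thesis by (simp add: mult.commute)
  qed
qed

lemma second_difference_test:
  fixes F :: "nat \<Rightarrow> real"
  assumes l: "lam > 0" "lam \<le> Lam" and Y: "Y \<ge> 1" and N: "real N \<le> Y + 1"
    and F: "\<And>n. n + 2 < N \<Longrightarrow> lam \<le> (F (n + 2) - F (n + 1)) - (F (n + 1) - F n)
                          \<and> (F (n + 2) - F (n + 1)) - (F (n + 1) - F n) \<le> Lam"
  shows "norm (esum F N) \<le> constA * (Lam * Y + 2) / sqrt lam"
proof -
  \<comment> \<open>The sequence is continued beyond \<open>N\<close> by a quadratic one with second difference \<open>lam\<close>.\<close>
  define g where "g n = (if n + 1 < N then F (n + 1) - F n
      else if N \<ge> 2 then F (N - 1) - F (N - 2) + lam * (real n - real (N - 2)) else lam * real n)" for n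
  define G where "G n = F 0 + (\<Sum>k<n. g k)" for n
  have "G n = F n" if "n < N" for n
    using that by (induction n) (simp_all add: G_def g_def)
  hence "esum F N = esum G N" by (simp add: esum_def)
  also have "norm \<dots> \<le> constA * (Lam * Y + 2) / sqrt lam"
  proof (rule second_difference_test_everywhere[OF l(1) Y N])
    fix n
    have "lam \<le> g (Suc n) - g n \<and> g (Suc n) - g n \<le> Lam"
    proof -
      consider "n + 2 < N" | "n + 2 = N" | "n + 1 \<ge> N" by linarith
      thus ?thesis
      proof cases
        case 1
        thus ?thesis using F[of n] by (simp add: g_def)
      next
        case 2
        hence "g n = F (N - 1) - F (N - 2)" "g (Suc n) = F (N - 1) - F (N - 2) + lam"
          by (auto simp: g_def)
        thus ?thesis using l by simp
      next
        case 3
        hence "g (Suc n) - g n = lam" by (auto simp: g_def algebra_simps)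
        thus ?thesis using l by simp
      qed
    qed
    thus "lam \<le> (G (n + 2) - G (n + 1)) - (G (n + 1) - G n) \<and> (G (n + 2) - G (n + 1)) - (G (n + 1) - G n) \<le> Lam"
      by (simp add: G_def)
  qed
  finally show ?thesis .
qed

section \<open>Iterated differencing\<close>

text \<open>The sequence behaves on \<open>{0..<N}\<close> like one with \<open>d\<close>-th derivative in \<open>[lam, Lam]\<close>. The truncated
  \<open>N - h\<close> makes the condition vacuous once a shift leaves the range.\<close>
primrec differences_between :: "nat \<Rightarrow> real \<Rightarrow> real \<Rightarrow> (nat \<Rightarrow> real) \<Rightarrow> nat \<Rightarrow> bool" where
  "differences_between 0 lam Lam F N \<longleftrightarrow> (\<forall>n<N. lam \<le> F n \<and> F n \<le> Lam)"
| "differences_between (Suc d) lam Lam F N \<longleftrightarrow>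
     (\<forall>h\<ge>1. differences_between d (lam * real h) (Lam * real h) (shift_diff h F) (N - h))"

text \<open>Induction on \<open>d\<close>: the function \<open>fd 0 (x + h) - fd 0 x\<close> on
  \<open>{a..b - h}\<close> has the derivatives \<open>fd k (x + h) - fd k x\<close>, and by the
  mean value theorem the one of order \<open>d\<close> is \<open>h\<close> times a value of
  \<open>fd (Suc d)\<close>.\<close>

lemma derivative_imp_differences_between:
  assumes "\<And>k x. k < d \<Longrightarrow> x \<in> {a..b} \<Longrightarrow> (fd k has_real_derivative fd (Suc k) x) (at x within {a..b})"
    and "\<And>x. x \<in> {a..b} \<Longrightarrow> lam \<le> fd d x \<and> fd d x \<le> Lam"
    and "\<And>n. n < N \<Longrightarrow> a + real n \<le> b"
    and "\<And>n. n < N \<Longrightarrow> F n = fd 0 (a + real n)"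
  shows "differences_between d lam Lam F N"
  using assms
proof (induction d arbitrary: b lam Lam fd F N)
  case 0
  show ?case unfolding differences_between.simps
  proof (intro allI impI)
    fix n assume n: "n < N"
    hence "a + real n \<in> {a..b}" using 0(3) by simp
    thus "lam \<le> F n \<and> F n \<le> Lam" using 0(2)[of "a + real n"] 0(4)[OF n] by simp
  qed
next
  case (Suc d)
  show ?case unfolding differences_between.simps
  proof (intro allI impI)
    fix h :: nat assume h: "h \<ge> 1"
    show "differences_between d (lam * real h) (Lam * real h) (shift_diff h F) (N - h)"
    proof (rule Suc.IH[where b = "b - real h" and fd = "\<lambda>k x. fd k (x + real h) - fd k x"])
      fix k x assume k: "k < d" and x: "x \<in> {a..b - real h}"
      have "(fd k has_real_derivative fd (Suc k) x) (at x within {a..b - real h})"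
        by (rule DERIV_subset[OF Suc.prems(1)]) (use k x in auto)
      moreover have "((\<lambda>x. fd k (x + real h)) has_real_derivative fd (Suc k) (x + real h)) (at x within {a..b - real h})"
      proof -
        have *: "(fd k has_real_derivative fd (Suc k) (x + real h)) (at (x + real h) within (\<lambda>x. x + real h) ` {a..b - real h})"
          by (rule DERIV_subset[OF Suc.prems(1)]) (use k x h in auto)
        have "((\<lambda>x. x + real h) has_real_derivative 1) (at x within {a..b - real h})"
          by (auto intro!: derivative_eq_intros)
        from DERIV_image_chain[OF * this] show ?thesis by (simp add: o_def)
      qed
      ultimately show "((\<lambda>x. fd k (x + real h) - fd k x) has_real_derivative
          fd (Suc k) (x + real h) - fd (Suc k) x) (at x within {a..b - real h})"
        by (intro DERIV_diff)
    next
      fix x assume x: "x \<in> {a..b - real h}"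
      have "\<exists>y\<in>{x<..<x + real h}. fd d (x + real h) - fd d x = (\<lambda>t. t * fd (Suc d) y) (x + real h - x)"
      proof (rule mvt_simple)
        fix y assume "x \<le> y" "y \<le> x + real h"
        hence "(fd d has_real_derivative fd (Suc d) y) (at y within {x..x + real h})"
          by (intro DERIV_subset[OF Suc.prems(1)]) (use x in auto)
        thus "(fd d has_derivative (\<lambda>t. t * fd (Suc d) y)) (at y within {x..x + real h})"
          by (simp add: has_field_derivative_def mult_commute_abs)
      qed (use h in auto)
      then obtain y where y: "y \<in> {x<..<x + real h}" "fd d (x + real h) - fd d x = real h * fd (Suc d) y"
        by auto
      have "y \<in> {a..b}" using x y(1) by auto
      hence "lam \<le> fd (Suc d) y \<and> fd (Suc d) y \<le> Lam" using Suc.prems(2) by blast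
      thus "lam * real h \<le> fd d (x + real h) - fd d x \<and> fd d (x + real h) - fd d x \<le> Lam * real h"
        unfolding y(2) by (simp add: mult.commute[of _ "real h"] mult_left_mono)
    next
      fix n assume n: "n < N - h"
      have "n + h < N" using n by linarith
      thus "a + real n \<le> b - real h" using Suc.prems(3)[of "n + h"] by simp
      show "shift_diff h F n = fd 0 (a + real n + real h) - fd 0 (a + real n)"
        using n Suc.prems(4)[of n] Suc.prems(4)[of "n + h"] by (simp add: shift_diff_def add.assoc)
    qed
  qed
qed

text \<open>Taking both shifts equal to 1 recovers the ordinary second differences.\<close>

lemma second_difference_test_differences_between:
  assumes "differences_between 2 lam Lam F N" "0 < lam" "lam \<le> Lam" "Y \<ge> 1" "real N \<le> Y + 1"
  shows "norm (esum F N) \<le> constA * (Lam * Y + 2) / sqrt lam"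
proof (rule second_difference_test)
  fix n assume n: "n + 2 < N"
  have "differences_between 0 (lam * real 1 * real 1) (Lam * real 1 * real 1)
      (shift_diff 1 (shift_diff 1 F)) (N - 1 - 1)"
    using assms(1) unfolding numeral_2_eq_2 differences_between.simps(2) by blast
  thus "lam \<le> (F (n + 2) - F (n + 1)) - (F (n + 1) - F n) \<and> (F (n + 2) - F (n + 1)) - (F (n + 1) - F n) \<le> Lam"
    using n by (simp add: shift_diff_def)
qed (use assms in auto)

text \<open>The Fejer coefficients of \<open>esum_van_der_corput\<close> after division by the
  square of \<open>H\<close>; the factor 2 accounts for the shifts \<open>h\<close> and
  \<open>-h\<close>.\<close>

definition weight :: "nat \<Rightarrow> nat \<Rightarrow> real" where
  "weight H h = 2 * (real H - real h) / (real H)\<^sup>2"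

lemma weight_nonneg: "h \<in> {1..<H} \<Longrightarrow> weight H h \<ge> 0"
  by (simp add: weight_def)

lemma sum_weight_le_1: "(\<Sum>h=1..<H. weight H h) \<le> 1"
proof -
  have "(\<Sum>h=1..<Suc n. real (Suc n) - real h) = real n * (real n + 1) / 2" for n
  proof (induction n)
    case (Suc n)
    have "(\<Sum>h=1..<Suc (Suc n). real (Suc (Suc n)) - real h)
        = (\<Sum>h=1..<Suc n. real (Suc (Suc n)) - real h) + 1"
      by simp
    also have "(\<Sum>h=1..<Suc n. real (Suc (Suc n)) - real h) = (\<Sum>h=1..<Suc n. (real (Suc n) - real h) + 1)"
      by (intro sum.cong refl) simp
    finally show ?case unfolding sum.distrib Suc by (simp add: field_simps)
  qed simp
  note * = this
  show ?thesis
  proof (cases H)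
    case (Suc n)
    have "(\<Sum>h=1..<H. weight H h) = 2 / (real H)\<^sup>2 * (\<Sum>h=1..<Suc n. real (Suc n) - real h)"
      unfolding sum_distrib_left weight_def Suc by (intro sum.cong refl) simp
    also have "\<dots> = real n / real H"
    proof -
      have "2 / x\<^sup>2 * (y * x / 2) = y / x" if "x > 0" for x y :: real
        using that by (simp add: power2_eq_square)
      from this[of "real n + 1" "real n"] show ?thesis unfolding * by (simp add: Suc add.commute)
    qed
    finally show ?thesis by (simp add: Suc)
  qed simp
qed

text \<open>\<open>1 / 3\<close> is the integral of \<open>2 * (1 - t) * t\<close> over the unit
  interval; the sum itself is evaluated in closed form by two inductions on
  \<open>H\<close>.\<close>

lemma sum_weight_mult_le: "(\<Sum>h=1..<H. weight H h * real h) \<le> real H / 3"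
proof (cases "H = 0")
  case False
  have "(\<Sum>h=1..<H. real h) = real H * (real H - 1) / 2" for H
  proof (induction H)
    case (Suc H)
    thus ?case by (cases "H = 0") (auto simp: field_simps)
  qed simp
  note 1 = this
  have "(\<Sum>h=1..<H. (real H - real h) * real h) = real H * ((real H)\<^sup>2 - 1) / 6" for H
  proof (induction H)
    case (Suc H)
    have "(\<Sum>h=1..<Suc H. (real (Suc H) - real h) * real h) = (\<Sum>h=1..<Suc H. (real H - real h) * real h + real h)"
      by (intro sum.cong) (auto simp: algebra_simps)
    also have "\<dots> = (\<Sum>h=1..<Suc H. (real H - real h) * real h) + (\<Sum>h=1..<Suc H. real h)"
      by (rule sum.distrib)
    also have "(\<Sum>h=1..<Suc H. (real H - real h) * real h) = (\<Sum>h=1..<H. (real H - real h) * real h)"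
      by (cases "H = 0") auto
    finally show ?case unfolding Suc 1 by (simp add: field_simps power2_eq_square)
  qed simp
  note 2 = this
  have "(\<Sum>h=1..<H. weight H h * real h) = 2 / (real H)\<^sup>2 * (\<Sum>h=1..<H. (real H - real h) * real h)"
    unfolding sum_distrib_left weight_def by (intro sum.cong refl) simp
  also have "\<dots> = ((real H)\<^sup>2 - 1) / (3 * real H)" unfolding 2 using False by (simp add: power2_eq_square field_simps)
  also have "\<dots> \<le> real H / 3" using False by (simp add: field_simps power2_eq_square)
  finally show ?thesis .
qed simp

text \<open>Jensen's inequality for the square: Cauchy-Schwarz with each weight split into two
  square roots, and total mass at most 1.\<close>

lemma weighted_mean_power2_le:
  assumes "\<And>h. h \<in> {1..<H} \<Longrightarrow> x h \<ge> 0"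
  shows "(\<Sum>h=1..<H. weight H h * x h)\<^sup>2 \<le> (\<Sum>h=1..<H. weight H h * (x h)\<^sup>2)"
proof -
  have "(\<Sum>h=1..<H. weight H h * x h) = (\<Sum>h=1..<H. sqrt (weight H h) * (sqrt (weight H h) * x h))"
    using weight_nonneg by (intro sum.cong refl) (auto simp: mult.assoc[symmetric])
  also have "\<dots>\<^sup>2 \<le> (\<Sum>h=1..<H. (sqrt (weight H h))\<^sup>2) * (\<Sum>h=1..<H. (sqrt (weight H h) * x h)\<^sup>2)"
    by (rule Cauchy_Schwarz_ineq_sum)
  also have "(\<Sum>h=1..<H. (sqrt (weight H h))\<^sup>2) = (\<Sum>h=1..<H. weight H h)"
    using weight_nonneg by (intro sum.cong refl) auto
  also have "(\<Sum>h=1..<H. (sqrt (weight H h) * x h)\<^sup>2) = (\<Sum>h=1..<H. weight H h * (x h)\<^sup>2)"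
    using weight_nonneg by (intro sum.cong refl) (auto simp: power_mult_distrib)
  also have "(\<Sum>h=1..<H. weight H h) * (\<Sum>h=1..<H. weight H h * (x h)\<^sup>2)
      \<le> 1 * (\<Sum>h=1..<H. weight H h * (x h)\<^sup>2)"
    using weight_nonneg by (intro mult_right_mono sum_weight_le_1 sum_nonneg mult_nonneg_nonneg) auto
  finally show ?thesis by simp
qed

lemma sum_weight_sqrt_le: "(\<Sum>h=1..<H. weight H h * sqrt (real h)) \<le> sqrt (real H / 3)"
proof (rule real_le_rsqrt)
  have "(\<Sum>h=1..<H. weight H h * sqrt (real h))\<^sup>2 \<le> (\<Sum>h=1..<H. weight H h * (sqrt (real h))\<^sup>2)"
    by (rule weighted_mean_power2_le) simp
  also have "\<dots> \<le> real H / 3" using sum_weight_mult_le by simp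
  finally show "(\<Sum>h=1..<H. weight H h * sqrt (real h))\<^sup>2 \<le> real H / 3" .
qed

text \<open>\<open>8 / 3\<close> is the integral of \<open>2 * (1 - t) / sqrt t\<close> over the
  unit interval. Raising \<open>H\<close> by one adds the sum of \<open>1 / sqrt h\<close> for
  \<open>h <= H\<close>, which is at most \<open>2 * sqrt H\<close> and hence at most the increment
  of \<open>4/3 * sqrt H ^ 3\<close>.\<close>

lemma sum_weight_inverse_sqrt_le: "(\<Sum>h=1..<H. weight H h / sqrt (real h)) \<le> 8 / 3 / sqrt (real H)"
proof (cases "H = 0")
  case False
  have step: "sqrt (real h) + 1 / sqrt (real h + 1) / 2 \<le> sqrt (real h + 1)" for h
  proof -
    define a b where "a = sqrt (real h)" and "b = sqrt (real h + 1)"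
    have ab: "a \<ge> 0" "b > 0" "b\<^sup>2 = a\<^sup>2 + 1" by (auto simp: a_def b_def)
    have "0 \<le> (b - a)\<^sup>2" by simp
    hence "2 * a * b + 1 \<le> 2 * b\<^sup>2" using ab(3) by (simp add: power2_eq_square algebra_simps)
    thus ?thesis using ab(2) unfolding a_def[symmetric] b_def[symmetric]
      by (simp add: field_simps power2_eq_square)
  qed
  have 1: "(\<Sum>h=1..<Suc H. 1 / sqrt (real h)) \<le> 2 * sqrt (real H)" for H
  proof (induction H)
    case (Suc H)
    thus ?case using step[of H] by (simp add: add_ac)
  qed simp
  have step2: "2 * sqrt (real h) \<le> 4/3 * (sqrt (real h + 1) ^ 3 - sqrt (real h) ^ 3)" for h
  proof -
    define a b where "a = sqrt (real h)" and "b = sqrt (real h + 1)"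
    have ab: "a \<ge> 0" "b > 0" "b\<^sup>2 = a\<^sup>2 + 1" "a \<le> b" by (auto simp: a_def b_def)
    \<comment> \<open>Since \<open>(b - a) * (b + a) = 1\<close>, it is enough to bound the second
      factor below by \<open>(b + a) * (3/2 * a)\<close>.\<close>
    have "b ^ 3 - a ^ 3 = (b - a) * (b * b + a * b + a * a)" by (simp add: power3_eq_cube algebra_simps)
    moreover have "(b - a) * (b + a) = 1" using ab(3) by (simp add: power2_eq_square algebra_simps)
    moreover have "(b - a) * (b * b + a * b + a * a) \<ge> (b - a) * ((b + a) * (3/2 * a))"
    proof (rule mult_left_mono)
      have "0 \<le> (b - a) * (b + a / 2)" using ab by (intro mult_nonneg_nonneg) auto
      moreover have "(b - a) * (b + a / 2) = (b * b + a * b + a * a) - (b + a) * (3/2 * a)"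
        by (simp add: field_simps)
      ultimately show "(b + a) * (3/2 * a) \<le> b * b + a * b + a * a" by linarith
    qed (use ab in auto)
    ultimately have "b ^ 3 - a ^ 3 \<ge> 3/2 * a" by (simp only: mult.assoc[symmetric])
    thus ?thesis unfolding a_def[symmetric] b_def[symmetric] by simp
  qed
  have "(\<Sum>h=1..<H. (real H - real h) / sqrt (real h)) \<le> 4/3 * sqrt (real H) ^ 3" for H
  proof (induction H)
    case (Suc H)
    have "(\<Sum>h=1..<Suc H. (real (Suc H) - real h) / sqrt (real h))
        = (\<Sum>h=1..<Suc H. (real H - real h) / sqrt (real h) + 1 / sqrt (real h))"
      by (intro sum.cong refl) (simp add: add_divide_distrib[symmetric] algebra_simps)
    also have "\<dots> = (\<Sum>h=1..<Suc H. (real H - real h) / sqrt (real h)) + (\<Sum>h=1..<Suc H. 1 / sqrt (real h))"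
      by (rule sum.distrib)
    also have "(\<Sum>h=1..<Suc H. (real H - real h) / sqrt (real h)) = (\<Sum>h=1..<H. (real H - real h) / sqrt (real h))"
      by (cases "H = 0") auto
    finally show ?case using Suc 1[of H] step2[of H] by (simp add: add_ac)
  qed simp
  note 2 = this
  have "(\<Sum>h=1..<H. weight H h / sqrt (real h)) = 2 / (real H)\<^sup>2 * (\<Sum>h=1..<H. (real H - real h) / sqrt (real h))"
    by (simp add: weight_def sum_distrib_left)
  also have "\<dots> \<le> 2 / (real H)\<^sup>2 * (4/3 * sqrt (real H) ^ 3)"
    by (intro mult_left_mono 2) auto
  also have "\<dots> = 8 / 3 / sqrt (real H)"
  proof -
    have *: "sqrt (real H) ^ 3 = real H * sqrt (real H)" by (simp add: power3_eq_cube)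
    have "real H = sqrt (real H) * sqrt (real H)" by simp
    thus ?thesis unfolding * using False by (simp add: field_simps power2_eq_square)
  qed
  finally show ?thesis .
qed simp

text \<open>Keeping the Fejer weights, rather than bounding them by \<open>2 / H\<close>, makes each mean have total mass at
  most 1; the factor 2 saved this way pays for rounding the \<open>H\<close> to integers.\<close>
fun weyl_mean :: "nat list \<Rightarrow> (nat \<Rightarrow> real) \<Rightarrow> nat \<Rightarrow> real" where
  "weyl_mean [] F N = norm (esum F N)"
| "weyl_mean (H # Hs) F N = (\<Sum>h=1..<H. weight H h * weyl_mean Hs (shift_diff h F) (N - h))"

lemma weyl_mean_nonneg: "weyl_mean Hs F N \<ge> 0"
  by (induction Hs arbitrary: F N) (auto intro!: sum_nonneg mult_nonneg_nonneg weight_nonneg)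

text \<open>The new length goes to the end of the list because differencing acts on the innermost
  sums. There \<open>N + H - 1 <= 2 * Y\<close> and \<open>N <= 5/4 * Y\<close>; the square passes
  through the outer means by \<open>weighted_mean_power2_le\<close>.\<close>

lemma weyl_mean_step:
  assumes H: "H \<ge> 1" "real H \<le> Y - 1" and Y: "Y \<ge> 4" and N: "real N \<le> Y + 1"
  shows "(weyl_mean Hs F N)\<^sup>2 \<le> 2 * (5/4 * Y\<^sup>2 / real H + Y * weyl_mean (Hs @ [H]) F N)"
  using N
proof (induction Hs arbitrary: F N)
  case Nil
  let ?S = "norm (esum F N)" and ?V = "weyl_mean [H] F N"
  have "(real H)\<^sup>2 * ?V = 2 * (\<Sum>h=1..<H. (real H - real h) * norm (esum (shift_diff h F) (N - h)))"
    unfolding weyl_mean.simps sum_distrib_left weight_def using H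
    by (intro sum.cong refl) (simp add: field_simps)
  hence "(real H)\<^sup>2 * ?S\<^sup>2 \<le> real (N + H - 1) * (real H * real N + (real H)\<^sup>2 * ?V)"
    using esum_van_der_corput[OF H(1), of F N] by simp
  also have "\<dots> \<le> (2 * Y) * (real H * (5/4 * Y) + (real H)\<^sup>2 * ?V)"
    using Nil Y H weyl_mean_nonneg[of "[H]" F N]
    by (intro mult_mono add_mono mult_left_mono add_nonneg_nonneg mult_nonneg_nonneg) auto
  also have "\<dots> = (real H)\<^sup>2 * (2 * (5/4 * Y\<^sup>2 / real H + Y * ?V))"
    using H by (simp add: field_simps power2_eq_square)
  finally have "?S\<^sup>2 \<le> 2 * (5/4 * Y\<^sup>2 / real H + Y * ?V)"
    by (rule mult_left_le_imp_le) (use H in simp)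
  thus ?case by simp
next
  case (Cons K Hs)
  let ?c = "5/4 * Y\<^sup>2 / real H"
  let ?v = "\<lambda>h. weyl_mean (Hs @ [H]) (shift_diff h F) (N - h)"
  have "(weyl_mean (K # Hs) F N)\<^sup>2 \<le> (\<Sum>h=1..<K. weight K h * (weyl_mean Hs (shift_diff h F) (N - h))\<^sup>2)"
    unfolding weyl_mean.simps by (rule weighted_mean_power2_le) (rule weyl_mean_nonneg)
  also have "\<dots> \<le> (\<Sum>h=1..<K. weight K h * (2 * (?c + Y * ?v h)))"
    using Cons.prems by (intro sum_mono mult_left_mono Cons.IH weight_nonneg) auto
  also have "\<dots> = 2 * (?c * (\<Sum>h=1..<K. weight K h) + Y * (\<Sum>h=1..<K. weight K h * ?v h))"
    unfolding sum_distrib_left sum.distrib[symmetric]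
    by (intro sum.cong refl) (simp add: algebra_simps)
  also have "\<dots> \<le> 2 * (?c * 1 + Y * (\<Sum>h=1..<K. weight K h * ?v h))"
    by (intro mult_left_mono add_right_mono sum_weight_le_1) auto
  finally show ?case by simp
qed

text \<open>A shift by \<open>h\<close> multiplies \<open>lam\<close> and \<open>Lam\<close> by
  \<open>h\<close>, hence the two terms of the second derivative test by \<open>sqrt h\<close> and
  \<open>1 / sqrt h\<close>; the weighted means of these give one factor per length.\<close>

lemma weyl_mean_le:
  assumes "differences_between (length Hs + 2) lam Lam F N" "0 < lam" "lam \<le> Lam"
    and Y: "Y \<ge> 1" and "real N \<le> Y + 1"
  shows "weyl_mean Hs F N \<le> constA * (Lam * Y / sqrt lam * (\<Prod>H\<leftarrow>Hs. sqrt (real H / 3))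
           + 2 / sqrt lam * (\<Prod>H\<leftarrow>Hs. 8 / 3 / sqrt (real H)))"
  using assms(1-3,5)
proof (induction Hs arbitrary: lam Lam F N)
  case Nil
  thus ?case using second_difference_test_differences_between[of lam Lam F N Y] Y
    by (simp add: add_divide_distrib[symmetric] numeral_2_eq_2[symmetric] del: differences_between.simps)
next
  case (Cons K Hs)
  let ?P = "\<Prod>H\<leftarrow>Hs. sqrt (real H / 3)" and ?R = "\<Prod>H\<leftarrow>Hs. 8 / 3 / sqrt (real H)"
  have P: "?P \<ge> 0" "?R \<ge> 0" by (auto intro!: prod_list_nonneg)
  have A: "constA > 0" using constA_bounds by simp
  have "weyl_mean Hs (shift_diff h F) (N - h)
      \<le> constA * (Lam * Y / sqrt lam * ?P * sqrt (real h) + 2 / sqrt lam * ?R / sqrt (real h))"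
    if h: "h \<in> {1..<K}" for h
  proof -
    have "weyl_mean Hs (shift_diff h F) (N - h) \<le> constA * ((Lam * real h) * Y / sqrt (lam * real h) * ?P
           + 2 / sqrt (lam * real h) * ?R)"
      using Cons.prems h by (intro Cons.IH) (auto intro!: mult_right_mono)
    also have "(Lam * real h) * Y / sqrt (lam * real h) = Lam * Y / sqrt lam * (real h / sqrt (real h))"
      by (simp add: real_sqrt_mult mult_ac)
    also have "real h / sqrt (real h) = sqrt (real h)" by (rule real_div_sqrt) simp
    also have "2 / sqrt (lam * real h) = 2 / sqrt lam / sqrt (real h)" by (simp add: real_sqrt_mult)
    finally show ?thesis by (simp add: mult_ac)
  qed
  hence "weyl_mean (K # Hs) F N \<le> (\<Sum>h=1..<K. weight K h *
      (constA * (Lam * Y / sqrt lam * ?P * sqrt (real h) + 2 / sqrt lam * ?R / sqrt (real h))))"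
    unfolding weyl_mean.simps by (intro sum_mono mult_left_mono weight_nonneg)
  also have "\<dots> = constA * (Lam * Y / sqrt lam * ?P * (\<Sum>h=1..<K. weight K h * sqrt (real h))
       + 2 / sqrt lam * ?R * (\<Sum>h=1..<K. weight K h / sqrt (real h)))"
    unfolding sum_distrib_left sum.distrib[symmetric]
    by (intro sum.cong refl) (simp add: algebra_simps)
  also have "\<dots> \<le> constA * (Lam * Y / sqrt lam * ?P * sqrt (real K / 3)
       + 2 / sqrt lam * ?R * (8 / 3 / sqrt (real K)))"
    using P A Cons.prems Y
    by (intro mult_left_mono add_mono sum_weight_sqrt_le sum_weight_inverse_sqrt_le) auto
  finally show ?case by (simp add: mult_ac)
qed

section \<open>Choice of the differencing lengths\<close>

lemma prod_list_le_power:
  fixes rs :: "real list"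
  assumes "\<And>r. r \<in> set rs \<Longrightarrow> 0 \<le> r \<and> r \<le> Z"
  shows "prod_list rs \<le> Z ^ length rs"
  using assms
proof (induction rs)
  case (Cons r rs)
  have "0 \<le> prod_list rs" using Cons.prems by (intro prod_list_nonneg) auto
  moreover have "0 \<le> r" "r \<le> Z" "prod_list rs \<le> Z ^ length rs" using Cons by auto
  ultimately show ?case by (auto intro!: mult_mono)
qed simp

lemma one_le_prod_list:
  fixes rs :: "real list"
  assumes "\<And>r. r \<in> set rs \<Longrightarrow> 1 \<le> r"
  shows "1 \<le> prod_list rs"
  using assms
proof (induction rs)
  case (Cons r rs)
  have "1 \<le> r" "1 \<le> prod_list rs" using Cons by simp_all
  hence "1 * 1 \<le> r * prod_list rs" by (intro mult_mono) auto
  thus ?case by simp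
qed simp

text \<open>Greedy choice of real lengths with product exactly \<open>P\<close>, each then rounded
  down. Every real length is at least 1, so rounding loses at most a factor 2 in each.\<close>

lemma exists_lengths_with_product:
  fixes rs :: "real list"
  assumes "\<And>r. r \<in> set rs \<Longrightarrow> 1 \<le> r \<and> r \<le> Z"
    and "prod_list rs \<le> P" "P \<le> Z ^ length rs"
  shows "\<exists>Hs::nat list. list_all2 (\<lambda>r H. r \<le> 2 * real H \<and> 1 \<le> H \<and> real H \<le> Z) rs Hs
     \<and> (\<Prod>H\<leftarrow>Hs. real H) \<le> P \<and> P \<le> 2 ^ length rs * (\<Prod>H\<leftarrow>Hs. real H)"
  using assms
proof (induction rs arbitrary: P)
  case (Cons r rs)
  define p where "p = prod_list rs"
  have "1 \<le> p"
    unfolding p_def by (rule one_le_prod_list) (use Cons.prems(1) in force)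
  have pZ: "p \<le> Z ^ length rs"
    unfolding p_def by (rule prod_list_le_power) (use Cons.prems(1) in force)
  have r: "1 \<le> r" "r \<le> Z" "r * p \<le> P" "P \<le> Z * Z ^ length rs" using Cons.prems by (auto simp: p_def)
  have "P > 0" using r \<open>1 \<le> p\<close> by (smt (verit) mult_pos_pos)
  \<comment> \<open>The largest length up to \<open>Z\<close> that leaves at least \<open>p\<close>,
    the product of the remaining lower bounds, for the rest.\<close>
  define y where "y = min Z (P / p)"
  have "r \<le> y" "y \<le> Z" using r \<open>1 \<le> p\<close> by (auto simp: y_def field_simps)
  with r(1) have y: "r \<le> y" "y \<le> Z" "1 \<le> y" by simp_all
  have "p \<le> P / y"
  proof -
    have "p * y \<le> p * (P / p)" unfolding y_def using \<open>1 \<le> p\<close> by (intro mult_left_mono) auto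
    thus ?thesis using y \<open>1 \<le> p\<close> by (simp add: field_simps)
  qed
  moreover have "P / y \<le> Z ^ length rs"
  proof (cases "Z \<le> P / p")
    case True
    hence "y = Z" by (simp add: y_def)
    thus ?thesis using r by (simp add: field_simps)
  next
    case False
    hence "P / y = p" using \<open>P > 0\<close> \<open>1 \<le> p\<close> by (simp add: y_def)
    thus ?thesis using pZ by simp
  qed
  ultimately obtain Hs where Hs: "list_all2 (\<lambda>r H. r \<le> 2 * real H \<and> 1 \<le> H \<and> real H \<le> Z) rs Hs"
     "(\<Prod>H\<leftarrow>Hs. real H) \<le> P / y" "P / y \<le> 2 ^ length rs * (\<Prod>H\<leftarrow>Hs. real H)"
    using Cons.IH[of "P / y"] Cons.prems(1) unfolding p_def by auto
  define H where "H = nat \<lfloor>y\<rfloor>"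
  have H: "1 \<le> H" "real H \<le> y" "y \<le> 2 * real H"
  proof -
    have "1 \<le> \<lfloor>y\<rfloor>" using y by simp
    hence "real H = of_int \<lfloor>y\<rfloor>" "1 \<le> real_of_int \<lfloor>y\<rfloor>" by (auto simp: H_def)
    thus "1 \<le> H" "real H \<le> y" "y \<le> 2 * real H" by linarith+
  qed
  have "(\<Prod>H\<leftarrow>H # Hs. real H) \<le> y * (P / y)"
    unfolding list.map prod_list.Cons
    using H Hs(2) y by (intro mult_mono) (auto intro!: prod_list_nonneg)
  moreover have "y * (P / y) \<le> (2 * real H) * (2 ^ length rs * (\<Prod>H\<leftarrow>Hs. real H))"
    using H Hs(3) y \<open>P > 0\<close> by (intro mult_mono) auto
  ultimately show ?case
    using H y Hs(1) by (intro exI[of _ "H # Hs"]) (auto simp: mult_ac)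
qed simp

text \<open>The constants \<open>2 * 2 ^ 2 ^ k + 4/5\<close> are stable under one step, and at \<open>k = 0\<close> stay below \<open>constB\<close>.\<close>
lemma weyl_mean_descent:
  assumes Y: "Y \<ge> 4" and N: "real N \<le> Y + 1" and R: "0 < R"
    and Hs: "\<And>k. k < length Hs \<Longrightarrow> 1 \<le> Hs ! k \<and> real (Hs ! k) \<le> Y - 1 \<and> 1 / R ^ (2 ^ Suc k) \<le> 2 * real (Hs ! k)"
    and top: "weyl_mean Hs F N \<le> (2 * 2 ^ (2 ^ length Hs) + 4/5) * R ^ (2 ^ length Hs) * Y"
  shows "norm (esum F N) \<le> (4 + 4/5) * R * Y"
proof -
  have "k \<le> length Hs \<Longrightarrow> weyl_mean (take k Hs) F N \<le> (2 * 2 ^ (2 ^ k) + 4/5) * R ^ (2 ^ k) * Y" for k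
  proof (induction rule: inc_induct)
    case base
    thus ?case using top by simp
  next
    case (step k)
    define x :: real where "x = 2 ^ (2 ^ k)"
    define t where "t = R ^ (2 ^ k)"
    define H where "H = Hs ! k"
    have x: "x \<ge> 2" unfolding x_def by (rule self_le_power) auto
    have x2: "2 ^ (2 ^ Suc k) = x\<^sup>2" by (simp add: x_def power_mult[symmetric] mult.commute)
    have t2: "R ^ (2 ^ Suc k) = t\<^sup>2" by (simp add: t_def power_mult[symmetric] mult.commute)
    have t: "t > 0" using R by (simp add: t_def)
    have H: "1 \<le> H" "real H \<le> Y - 1" "1 / t\<^sup>2 \<le> 2 * real H"
      using Hs[OF step(2)] unfolding t2 H_def by auto
    have "1 / real H \<le> 2 * t\<^sup>2" using H t by (simp add: field_simps)
    hence 1: "5/4 * Y\<^sup>2 / real H \<le> 5/4 * Y\<^sup>2 * (2 * t\<^sup>2)"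
      using mult_left_mono[of "1 / real H" "2 * t\<^sup>2" "5/4 * Y\<^sup>2"] by simp
    have "weyl_mean (take k Hs @ [H]) F N \<le> (2 * x\<^sup>2 + 4/5) * t\<^sup>2 * Y"
      using step(3) unfolding take_Suc_conv_app_nth[OF step(2)] x2 t2 H_def[symmetric] .
    hence 2: "Y * weyl_mean (take k Hs @ [H]) F N \<le> Y * ((2 * x\<^sup>2 + 4/5) * t\<^sup>2 * Y)"
      using Y by (intro mult_left_mono) auto
    have "(weyl_mean (take k Hs) F N)\<^sup>2 \<le> 2 * (5/4 * Y\<^sup>2 / real H + Y * weyl_mean (take k Hs @ [H]) F N)"
      by (rule weyl_mean_step) (use H Y N in auto)
    also have "\<dots> \<le> 2 * (5/4 * Y\<^sup>2 * (2 * t\<^sup>2) + Y * ((2 * x\<^sup>2 + 4/5) * t\<^sup>2 * Y))"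
      by (intro mult_left_mono add_mono 1 2) auto
    also have "\<dots> = (4 * x\<^sup>2 + 33/5) * (t * Y)\<^sup>2"
      by (simp add: power2_eq_square field_simps)
    also have "\<dots> \<le> (2 * x + 4/5)\<^sup>2 * (t * Y)\<^sup>2"
    proof (rule mult_right_mono)
      \<comment> \<open>After expansion this is \<open>33/5 <= 16/5 * x + 16/25\<close>, which
        \<open>x >= 2\<close> provides.\<close>
      show "4 * x\<^sup>2 + 33/5 \<le> (2 * x + 4/5)\<^sup>2" using x by (simp add: power2_eq_square field_simps)
    qed simp
    also have "\<dots> = ((2 * x + 4/5) * t * Y)\<^sup>2"
      by (simp add: power_mult_distrib)
    finally show ?case unfolding x_def[symmetric] t_def[symmetric]
      by (rule power2_le_imp_le) (use x t Y in auto)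
  qed
  from this[of 0] show ?thesis by simp
qed

section \<open>Numerical inequalities and products over the lengths\<close>

lemma two_mult_le_power2: "q \<ge> 1 \<Longrightarrow> 2 * q \<le> (2::nat) ^ q"
proof (induction q rule: dec_induct)
  case (step q)
  have "(2::nat) ^ 1 \<le> 2 ^ q" using step by (intro power_increasing) auto
  thus ?case using step by simp
qed simp

text \<open>Since \<open>Q >= 2 * q\<close>, powers with exponent \<open>q\<close> are dominated by
  powers with exponent \<open>Q\<close>, and comparisons with \<open>2.2 ^ q\<close> need only be
  made at \<open>q = 1\<close>. The base 2.2 rounds up \<open>8/3 * sqrt (2/3)\<close>, the factor
  per length in the decreasing term.\<close>

lemma double_exponential_bounds:
  assumes "q \<ge> (1::nat)"
  defines "Q \<equiv> (2::nat) ^ q"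
  shows "4 ^ q \<le> (2::real) ^ Q"
    and "constB\<^sup>2 * 2 \<le> (8::real) ^ Q"
    and "4 * constA\<^sup>2 * 2.2 ^ q \<le> 3/2 * 8 ^ Q"
    and "2 * constB * 2.2 ^ q \<le> 6 * 2 ^ Q"
proof -
  have "(2::real) ^ (2 * q) \<le> 2 ^ Q"
    unfolding Q_def using two_mult_le_power2[OF assms(1)] by (intro power_increasing) auto
  thus 4: "4 ^ q \<le> (2::real) ^ Q" by (simp add: power_mult)
  have "(4 ^ q) ^ 3 \<le> ((2::real) ^ Q) ^ 3" using 4 by (intro power_mono) auto
  hence 8: "64 ^ q \<le> (8::real) ^ Q" by (simp flip: power_mult add: power_mult[of _ 3] mult.commute[of _ 3])
  have "(64::real) ^ 1 \<le> 64 ^ q" using assms by (intro power_increasing) auto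
  moreover have "constB\<^sup>2 \<le> 4.83\<^sup>2" using constB_bounds by (intro power_mono) auto
  ultimately show "constB\<^sup>2 * 2 \<le> (8::real) ^ Q" using 8 by (simp add: power2_eq_square)
  have *: "(2.2::real) ^ q \<le> 2.2 / c * c ^ q" if "c \<ge> 2.2" for c
  proof -
    have "(2.2 / c) ^ q \<le> (2.2 / c) ^ 1" using that assms by (intro power_decreasing) auto
    thus ?thesis using that by (simp add: power_divide field_simps)
  qed
  have "constA\<^sup>2 \<le> 2.8\<^sup>2" using constA_bounds by (intro power_mono) auto
  hence "4 * constA\<^sup>2 * 2.2 ^ q \<le> 4 * 2.8\<^sup>2 * (2.2 / 64 * 64 ^ q)"
    using *[of 64] by (intro mult_mono) auto
  also have "\<dots> \<le> 3/2 * 64 ^ q" by (simp add: power2_eq_square)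
  finally show "4 * constA\<^sup>2 * 2.2 ^ q \<le> 3/2 * 8 ^ Q" using 8 by linarith
  have "2 * constB * 2.2 ^ q \<le> 2 * 4.83 * (2.2 / 4 * 4 ^ q)"
    using *[of 4] constB_bounds by (intro mult_mono) auto
  also have "\<dots> \<le> 6 * 4 ^ q" by simp
  finally show "2 * constB * 2.2 ^ q \<le> 6 * 2 ^ Q" using 4 by linarith
qed

lemma prod_list_sqrt_divide: "(\<Prod>H\<leftarrow>Hs. sqrt (real H / c)) = sqrt (\<Prod>H\<leftarrow>Hs. real H) / sqrt c ^ length Hs"
  by (induction Hs) (auto simp: real_sqrt_mult real_sqrt_divide)

lemma prod_list_divide_sqrt: "(\<Prod>H\<leftarrow>Hs. c / sqrt (real H)) = c ^ length Hs / sqrt (\<Prod>H\<leftarrow>Hs. real H)"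
  by (induction Hs) (auto simp: real_sqrt_mult)

text \<open>The exponents form a geometric progression from 2 to \<open>2 ^ q\<close>.\<close>

lemma prod_list_inverse_powers:
  fixes R :: real
  shows "prod_list (map (\<lambda>k. 1 / R ^ (2 ^ Suc k)) [0..<q]) = 1 / R ^ (2 * 2 ^ q - 2)"
proof (induction q)
  case (Suc q)
  have "2 * 2 ^ Suc q - 2 = (2 * 2 ^ q - 2) + (2::nat) ^ Suc q" using one_le_power[of "2::nat" q] by simp
  hence "R ^ (2 * 2 ^ Suc q - 2) = R ^ (2 * 2 ^ q - 2) * R ^ (2 ^ Suc q)" by (simp only: power_add)
  thus ?case using Suc by (simp del: power_Suc)
qed simp

text \<open>Here \<open>q = d - 2\<close> and \<open>Q = D / 4\<close>. \<open>Ra\<close>,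
  \<open>Rb\<close> and \<open>Rc\<close> express that \<open>constB * R\<close> dominates the three
  terms of the maximum, raised to the powers \<open>2 * Q\<close>, \<open>4 * Q - 2\<close> and
  \<open>Q\<close>; in \<open>Ra\<close> and \<open>Rc\<close> powers of \<open>d - 2\<close>, which
  are at least 1, have been discarded.\<close>

lemma norm_esum_le_of_differences:
  fixes q :: nat and R Y lam Lam :: real
  defines "Q \<equiv> (2::nat) ^ q"
  assumes q: "q \<ge> 1" and Y: "Y \<ge> 4" and N: "real N \<le> Y + 1" and lam: "0 < lam" "lam \<le> Lam"
    and F: "differences_between (q + 2) lam Lam F N" and R: "0 < R" "R \<le> 1"
    and Ra: "2 ^ Q * (Lam / (lam * Y)) \<le> R ^ (2 * Q)"
    and Rb: "2 ^ (Q + 1) * (2 / 3) ^ (2 * q) * constA\<^sup>2 / constB\<^sup>2 * (Lam\<^sup>2 / lam) \<le> R ^ (4 * Q - 2)"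
    and Rc: "4 * 2 ^ q * constA / constB / sqrt (lam * Y ^ (q + 2)) \<le> R ^ Q"
  shows "norm (esum F N) \<le> constB * R * Y"
proof -
  have A: "constA > 0" and B: "constB > 0" using constA_bounds constB_bounds by auto
  have Lam: "Lam > 0" using lam by simp
  have Q: "2 \<le> Q" unfolding Q_def using q self_le_power[of "2::nat" q] by simp
  define rs where "rs = map (\<lambda>k. 1 / R ^ (2 ^ Suc k)) [0..<q]"
  have len: "length rs = q" by (simp add: rs_def)
  \<comment> \<open>The product at which the growing term of the second derivative test equals \<open>2 ^ Q * R ^ Q * Y / 2\<close>.\<close>
  define P0 where "P0 = 1/4 * (2 ^ Q * R ^ Q)\<^sup>2 * 3 ^ q * lam / (constA\<^sup>2 * Lam\<^sup>2)"
  \<comment> \<open>The cap is the largest product that \<open>q\<close> lengths up to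
    \<open>Y - 1\<close> can have.\<close>
  define P where "P = min P0 ((Y - 1) ^ q)"
  \<comment> \<open>\<open>Ra\<close> with \<open>Lam >= lam\<close> and \<open>2 ^ Q >= 4\<close>
    gives \<open>R ^ (2 * Q) >= 4 / Y\<close>, so every lower bound is at most
    \<open>Y / 4\<close>.\<close>
  have rs: "1 \<le> r \<and> r \<le> Y - 1" if r: "r \<in> set rs" for r
  proof -
    obtain k where k: "k < q" "r = 1 / R ^ (2 ^ Suc k)" using r by (auto simp: rs_def simp del: power_Suc)
    have "(2::nat) ^ Suc k \<le> 2 * Q"
      unfolding Q_def using k power_increasing[of k q "2::nat"] by simp
    hence "R ^ (2 * Q) \<le> R ^ (2 ^ Suc k)" using R by (intro power_decreasing) auto
    moreover have "4 * (1 / Y) \<le> 2 ^ Q * (Lam / (lam * Y))"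
    proof (rule mult_mono)
      show "(4::real) \<le> 2 ^ Q" using power_increasing[of 2 Q "2::real"] Q by simp
      show "1 / Y \<le> Lam / (lam * Y)" using lam Y by (simp add: field_simps)
    qed (use Y in auto)
    ultimately have "4 / Y \<le> R ^ (2 ^ Suc k)" using Ra by simp
    hence "1 / R ^ (2 ^ Suc k) \<le> 1 / (4 / Y)" using Y R by (intro divide_left_mono mult_pos_pos) auto
    hence "r \<le> Y / 4" using k by simp
    moreover have "R ^ (2 ^ Suc k) \<le> 1" using R by (intro power_le_one) auto
    hence "1 \<le> r" using R k by simp
    ultimately show ?thesis using Y by linarith
  qed
  \<comment> \<open>\<open>Rb\<close> enters here: its exponent splits into \<open>2 * Q\<close>
    from \<open>P0\<close> and \<open>2 * Q - 2\<close> from the product of the lower bounds. What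
    remains is the numerical inequality \<open>2 * constB ^ 2 <= w\<close>.\<close>
  have "prod_list rs \<le> P0"
  proof -
    define w :: real where "w = 3 ^ q * (2 / 3) ^ (2 * q) * (2 ^ Q)\<^sup>2 * 2 ^ Q"
    have "1 * (constB\<^sup>2 * 2) \<le> (4/3) ^ q * 8 ^ Q"
      using double_exponential_bounds(2)[OF q] B by (intro mult_mono) (auto simp: Q_def one_le_power)
    moreover have "(4/3::real) ^ q * 8 ^ Q = 3 ^ q * (2 / 3) ^ (2 * q) * (2 ^ Q)\<^sup>2 * 2 ^ Q"
    proof -
      have "(8::real) ^ Q = (2 ^ Q)\<^sup>2 * 2 ^ Q"
        by (simp add: power2_eq_square power_mult_distrib[symmetric])
      moreover have "3 ^ q * (2 / 3::real) ^ (2 * q) = (4/3) ^ q"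
        by (simp add: power_mult power_mult_distrib[symmetric] power2_eq_square)
      ultimately show ?thesis by simp
    qed
    ultimately have "constB\<^sup>2 * 2 \<le> w" by (simp add: w_def)
    hence "4 \<le> 2 * w / constB\<^sup>2" using B by (simp add: field_simps)
    also have "\<dots> = (2 ^ Q)\<^sup>2 * 3 ^ q * (2 ^ (Q + 1) * (2 / 3) ^ (2 * q) / constB\<^sup>2)"
      by (simp add: w_def mult_ac)
    also have "\<dots> = (2 ^ Q)\<^sup>2 * 3 ^ q * lam / (constA\<^sup>2 * Lam\<^sup>2)
        * (2 ^ (Q + 1) * (2 / 3) ^ (2 * q) * constA\<^sup>2 / constB\<^sup>2 * (Lam\<^sup>2 / lam))"
      using A lam Lam by simp
    also have "\<dots> \<le> (2 ^ Q)\<^sup>2 * 3 ^ q * lam / (constA\<^sup>2 * Lam\<^sup>2) * R ^ (4 * Q - 2)"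
      using lam by (intro mult_left_mono Rb) auto
    also have "4 * Q - 2 = 2 * Q + (2 * Q - 2)" using Q by simp
    also have "(2 ^ Q)\<^sup>2 * 3 ^ q * lam / (constA\<^sup>2 * Lam\<^sup>2) * R ^ (2 * Q + (2 * Q - 2)) = 4 * (P0 * R ^ (2 * Q - 2))"
      by (simp add: P0_def power_add power_mult_distrib power_mult[of R Q 2, symmetric] mult.commute[of Q 2])
    finally have "1 \<le> P0 * R ^ (2 * Q - 2)" by simp
    hence "1 / R ^ (2 * Q - 2) \<le> P0" using R by (simp add: field_simps)
    thus ?thesis unfolding rs_def Q_def prod_list_inverse_powers .
  qed
  moreover have "prod_list rs \<le> (Y - 1) ^ q"
    using prod_list_le_power[of rs "Y - 1"] rs len by force
  ultimately have "prod_list rs \<le> P" by (simp add: P_def)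
  moreover have "P \<le> (Y - 1) ^ length rs" by (simp add: P_def len)
  ultimately obtain Hs :: "nat list"
    where Hs: "list_all2 (\<lambda>r H. r \<le> 2 * real H \<and> 1 \<le> H \<and> real H \<le> Y - 1) rs Hs"
      and PH: "(\<Prod>H\<leftarrow>Hs. real H) \<le> P" "P \<le> 2 ^ q * (\<Prod>H\<leftarrow>Hs. real H)"
    using exists_lengths_with_product[of rs "Y - 1" P] rs len by auto
  have lenH: "length Hs = q" using list_all2_lengthD[OF Hs] len by simp
  define p where "p = (\<Prod>H\<leftarrow>Hs. real H)"
  have P0: "P0 > 0" using R A Lam lam by (simp add: P0_def)
  hence "P > 0" using Y by (simp add: P_def)
  have "0 < 2 ^ q * p" using PH(2) \<open>P > 0\<close> unfolding p_def[symmetric] by linarith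
  hence p: "p > 0" "p \<le> P0" "P \<le> 2 ^ q * p"
    using PH by (simp_all add: p_def[symmetric] zero_less_mult_iff) (simp add: P_def)
  have sl: "sqrt lam > 0" "sqrt lam * sqrt lam = lam" using lam by auto
  have sP0: "sqrt P0 = 1/2 * (2 ^ Q * R ^ Q) * sqrt 3 ^ q * sqrt lam / (constA * Lam)"
    using A Lam lam R unfolding P0_def
    by (simp add: real_sqrt_divide real_sqrt_mult real_sqrt_power[symmetric] real_sqrt_abs)
  have first: "constA * (Lam * Y / sqrt lam * (sqrt p / sqrt 3 ^ q)) \<le> 1/2 * (2 ^ Q * R ^ Q) * Y"
  proof -
    have "constA * (Lam * Y / sqrt lam * (sqrt p / sqrt 3 ^ q))
        \<le> constA * (Lam * Y / sqrt lam * (sqrt P0 / sqrt 3 ^ q))"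
      using A Lam Y sl p by (intro mult_left_mono divide_right_mono) auto
    also have "\<dots> = 1/2 * (2 ^ Q * R ^ Q) * Y" unfolding sP0 using A Lam sl by simp
    finally show ?thesis .
  qed
  \<comment> \<open>The decreasing term needs \<open>p\<close> bounded below; using
    \<open>P <= 2 ^ q * p\<close> costs a factor \<open>sqrt 2 ^ q\<close>.\<close>
  have second: "constA * (2 / sqrt lam * ((8/3) ^ q / sqrt p)) \<le> 3/2 * (2 ^ Q * R ^ Q) * Y"
  proof -
    have "sqrt P \<le> sqrt 2 ^ q * sqrt p" using p(3) by (metis real_sqrt_le_iff real_sqrt_mult real_sqrt_power)
    hence "1 / sqrt p \<le> sqrt 2 ^ q / sqrt P" using p \<open>P > 0\<close> by (simp add: field_simps)
    hence *: "constA * (2 / sqrt lam * ((8/3) ^ q / sqrt p)) \<le> constA * (2 / sqrt lam * ((8/3) ^ q * (sqrt 2 ^ q / sqrt P)))"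
      using A sl mult_left_mono[of "1 / sqrt p" "sqrt 2 ^ q / sqrt P" "(8/3) ^ q"]
      by (intro mult_left_mono) auto
    also have "\<dots> \<le> 3/2 * (2 ^ Q * R ^ Q) * Y"
    proof (cases "P0 \<le> (Y - 1) ^ q")
      case True
      hence P: "P = P0" by (simp add: P_def)
      have "8/3 * (sqrt 2 / sqrt 3) \<le> 2.2"
      proof -
        have "sqrt (2/3) \<le> 0.82" by (rule real_le_lsqrt) (simp_all add: power2_eq_square)
        thus ?thesis by (simp add: real_sqrt_divide)
      qed
      hence "(8/3 * (sqrt 2 / sqrt 3)) ^ q \<le> 2.2 ^ q" by (intro power_mono) auto
      hence "4 * constA\<^sup>2 * (8/3 * (sqrt 2 / sqrt 3)) ^ q \<le> 4 * constA\<^sup>2 * 2.2 ^ q"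
        by (intro mult_left_mono) auto
      hence k: "4 * constA\<^sup>2 * (8/3 * (sqrt 2 / sqrt 3)) ^ q \<le> 3/2 * 8 ^ Q"
        using double_exponential_bounds(3)[OF q] by (simp add: Q_def)
      have alg: "x * (2 / s * (g * (t / (1/2 * w * u * s / (x * l))))) = 4 * x\<^sup>2 * (g * (t / u)) * (l / (s * s)) / w"
        if "x > 0" "s > 0" "u > 0" "l > 0" "w > 0" for x s g t w u l :: real
        using that by (simp add: power2_eq_square mult_ac)
      have pow: "(8/3 * (sqrt 2 / sqrt 3)) ^ q = (8/3) ^ q * (sqrt 2 ^ q / sqrt 3 ^ q)"
        by (simp only: power_mult_distrib power_divide)
      have 8: "(8::real) ^ Q = 2 ^ Q * 2 ^ Q * 2 ^ Q" by (simp flip: power_mult_distrib)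
      have "constA * (2 / sqrt lam * ((8/3) ^ q * (sqrt 2 ^ q / sqrt P)))
          = (4 * constA\<^sup>2 * (8/3 * (sqrt 2 / sqrt 3)) ^ q) * (Lam / lam) / (2 ^ Q * R ^ Q)"
        unfolding P sP0 pow by (subst alg) (use A Lam sl R in auto)
      also have "\<dots> \<le> 3/2 * 8 ^ Q * (Lam / lam) / (2 ^ Q * R ^ Q)"
        using k Lam lam R by (intro divide_right_mono mult_right_mono) auto
      also have "3/2 * 8 ^ Q * (Lam / lam) / (2 ^ Q * R ^ Q)
          = 3/2 * 2 ^ Q * Y * (2 ^ Q * (Lam / (lam * Y))) / R ^ Q"
        unfolding 8 using Y lam R by simp
      finally have "constA * (2 / sqrt lam * ((8/3) ^ q * (sqrt 2 ^ q / sqrt P)))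
          \<le> 3/2 * 2 ^ Q * Y * (2 ^ Q * (Lam / (lam * Y))) / R ^ Q" .
      moreover have "3/2 * 2 ^ Q * Y * (2 ^ Q * (Lam / (lam * Y))) / R ^ Q \<le> 3/2 * 2 ^ Q * Y * R ^ (2 * Q) / R ^ Q"
        using Y R by (intro divide_right_mono mult_left_mono Ra) auto
      moreover have "3/2 * 2 ^ Q * Y * R ^ (2 * Q) / R ^ Q = 3/2 * (2 ^ Q * R ^ Q) * Y"
      proof -
        have "R ^ (2 * Q) = R ^ Q * R ^ Q" by (simp add: power_add[symmetric] mult_2)
        thus ?thesis using R by simp
      qed
      ultimately show ?thesis by linarith
    next
      case False
      hence P: "P = (Y - 1) ^ q" by (simp add: P_def)
      have sY: "sqrt Y > 0" "sqrt Y * sqrt Y = Y" using Y by auto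
      \<comment> \<open>The \<open>8/3\<close> under the root is \<open>2 / (3/4)\<close>, from
        \<open>Y - 1 >= 3/4 * Y\<close>, which holds as \<open>Y >= 4\<close>.\<close>
      have "sqrt 2 / sqrt (Y - 1) \<le> sqrt (8/3) / sqrt Y"
      proof -
        have "2 / (Y - 1) \<le> (8/3) / Y" using Y by (simp add: field_simps)
        thus ?thesis by (metis real_sqrt_divide real_sqrt_le_iff)
      qed
      moreover have "sqrt (8/3) \<le> 1.65" by (rule real_le_lsqrt) (simp_all add: power2_eq_square)
      ultimately have "sqrt 2 / sqrt (Y - 1) \<le> 1.65 / sqrt Y"
        using sY by (meson divide_right_mono less_imp_le order_trans)
      hence "8/3 * (sqrt 2 / sqrt (Y - 1)) \<le> 2 * 2.2 / sqrt Y" by (simp add: field_simps)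
      hence "(8/3 * (sqrt 2 / sqrt (Y - 1))) ^ q \<le> (2 * 2.2 / sqrt Y) ^ q"
        using Y by (intro power_mono) auto
      hence "constA * (2 / sqrt lam * (8/3 * (sqrt 2 / sqrt (Y - 1))) ^ q) \<le> constA * (2 / sqrt lam * (2 * 2.2 / sqrt Y) ^ q)"
        using A sl by (intro mult_left_mono) auto
      hence "constA * (2 / sqrt lam * ((8/3) ^ q * (sqrt 2 ^ q / sqrt P)))
          \<le> constA * (2 / sqrt lam * (2 * 2.2 / sqrt Y) ^ q)"
        unfolding P by (simp add: power_mult_distrib power_divide real_sqrt_power)
      also have "\<dots> = (2 * constB * 2.2 ^ q) / 4 * (4 * 2 ^ q * constA / constB / sqrt (lam * Y ^ (q + 2))) * Y"
      proof -
        have alg: "x * (2 / s * (u * v / y)) = (2 * b * v) / 4 * (4 * u * x / b / (s * (y * z))) * z"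
          if "b > 0" "s > 0" "y > 0" "z > 0" for x s u v y z b :: real
          using that by simp
        have "(2 * 2.2 / sqrt Y) ^ q = 2 ^ q * 2.2 ^ q / sqrt Y ^ q"
          by (simp only: power_mult_distrib power_divide)
        moreover have "sqrt (lam * Y ^ (q + 2)) = sqrt lam * (sqrt Y ^ q * Y)"
          using Y by (simp add: real_sqrt_mult real_sqrt_power power_add power2_eq_square)
        ultimately show ?thesis using B sl sY Y by (simp only:) (rule alg; simp)
      qed
      also have "\<dots> \<le> (6 * 2 ^ Q) / 4 * R ^ Q * Y"
        by (rule mult_right_mono[OF mult_mono[OF divide_right_mono[OF double_exponential_bounds(4)[OF q, folded Q_def]] Rc]])
          (use A B Y R lam in auto)
      finally show ?thesis by simp
    qed
    finally show ?thesis .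
  qed
  have "weyl_mean Hs F N \<le> constA * (Lam * Y / sqrt lam * (sqrt p / sqrt 3 ^ q)) + constA * (2 / sqrt lam * ((8/3) ^ q / sqrt p))"
    using weyl_mean_le[of Hs lam Lam F N Y] F lam Y N
    unfolding lenH prod_list_sqrt_divide prod_list_divide_sqrt p_def[symmetric]
    by (simp add: distrib_left)
  also have "\<dots> \<le> (2 * 2 ^ Q + 4/5) * R ^ Q * Y"
  proof -
    \<comment> \<open>The shares 1/2 and 3/2 of the two terms add up to the coefficient 2; the
      additional \<open>4/5\<close> belongs to the invariant of
      \<open>weyl_mean_descent\<close>.\<close>
    have "(2 * 2 ^ Q + 4/5) * R ^ Q * Y = 1/2 * (2 ^ Q * R ^ Q) * Y + 3/2 * (2 ^ Q * R ^ Q) * Y + 4/5 * R ^ Q * Y"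
      by (simp add: algebra_simps)
    moreover have "4/5 * R ^ Q * Y \<ge> 0" using R Y by simp
    ultimately show ?thesis using first second by linarith
  qed
  finally have top: "weyl_mean Hs F N \<le> (2 * 2 ^ Q + 4/5) * R ^ Q * Y" .
  have "norm (esum F N) \<le> (4 + 4/5) * R * Y"
  proof (rule weyl_mean_descent[OF Y N R(1)])
    fix k assume k: "k < length Hs"
    have "rs ! k = 1 / R ^ (2 ^ Suc k)" using k by (simp add: rs_def lenH)
    thus "1 \<le> Hs ! k \<and> real (Hs ! k) \<le> Y - 1 \<and> 1 / R ^ (2 ^ Suc k) \<le> 2 * real (Hs ! k)"
      using list_all2_nthD2[OF Hs k] by auto
  qed (use top in \<open>simp add: lenH Q_def\<close>)
  also have "\<dots> \<le> constB * R * Y"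
    using constB_bounds R Y by (intro mult_right_mono) auto
  finally show ?thesis .
qed

section \<open>From the stated maximum to power inequalities for its quotient by
  \<open>constB\<close>\<close>

lemma powr_power_cancel:
  assumes "(x::real) > 0" "a * real n = 1"
  shows "(x powr a) ^ n = x"
  using assms by (simp add: powr_realpow[symmetric] powr_powr)

text \<open>The family \<open>fd\<close> represents the derivatives of \<open>f\<close> on the
  half-open interval; at the right end \<open>X + Y\<close> they are one-sided.\<close>

theorem theorem11:
  fixes d :: nat and X Y lam Lam :: real and f :: "real \<Rightarrow> real"
    and fd :: "nat \<Rightarrow> real \<Rightarrow> real"
  assumes hd: "d \<ge> 3"
    and hY: "\<lfloor>Y\<rfloor> > int d"
    and hf0: "\<And>x. x \<in> {X<..X+Y} \<Longrightarrow> fd 0 x = f x"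
    and hderiv: "\<And>k x. k < d \<Longrightarrow> x \<in> {X<..X+Y} \<Longrightarrow>
                  (fd k has_real_derivative fd (Suc k) x) (at x within {X<..X+Y})"
    and hcont: "continuous_on {X<..X+Y} (fd d)"
    and hlam: "0 < lam"
    and hbounds: "\<And>x. x \<in> {X<..X+Y} \<Longrightarrow> lam \<le> fd d x \<and> fd d x \<le> Lam"
  shows "norm ((1 / of_real Y) * (\<Sum>n\<in>{n::int. X < of_int n \<and> of_int n \<le> X + Y}. e (f (of_int n))))
         \<le> max (A_d d * (Lam / (lam * Y)) powr (2 / 2 ^ d))
             (max (B_d d * (Lam\<^sup>2 / lam) powr (1 / (2 ^ d - 2)))
                  (C_d d * (lam * Y ^ d) powr (- 2 / 2 ^ d)))"
  (is "?lhs \<le> ?M")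
proof -
  define q where "q = d - 2"
  define Q :: nat where "Q = 2 ^ q"
  have q: "q \<ge> 1" "d = q + 2" "real d - 2 = real q" using hd by (auto simp: q_def)
  have Q: "Q \<ge> 2" unfolding Q_def using q self_le_power[of "2::nat" q] by simp
  have D: "(2::real) ^ d = 4 * real Q" by (simp add: q Q_def power_add)
  have Y: "Y \<ge> 4" using hY hd by linarith
  have A: "constA > 0" and B: "constB > 0" using constA_bounds constB_bounds by auto
  have "lam \<le> Lam" using hbounds[of "X + Y"] Y by auto
  hence Lam: "lam \<le> Lam" "Lam > 0" using hlam by auto

  \<comment> \<open>The least integer above \<open>X\<close>, so that the closed interval from
    \<open>a\<close> to \<open>X + Y\<close> lies in the domain and the summation points are
    \<open>a + n\<close> with \<open>n < N\<close>.\<close>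
  define a where "a = \<lfloor>X\<rfloor> + 1"
  define N where "N = nat (\<lfloor>X + Y\<rfloor> - \<lfloor>X\<rfloor>)"
  define F where "F n = f (of_int a + real n)" for n :: nat
  have N: "real N \<le> Y + 1"
  proof -
    have "\<lfloor>X\<rfloor> \<le> \<lfloor>X + Y\<rfloor>" using Y by (intro floor_mono) auto
    hence "real N = of_int \<lfloor>X + Y\<rfloor> - of_int \<lfloor>X\<rfloor>" by (simp add: N_def)
    thus ?thesis by linarith
  qed
  have aX: "X < of_int a" unfolding a_def by linarith
  have aN: "of_int a + real n \<le> X + Y" if "n < N" for n
  proof -
    have "a + int n \<le> \<lfloor>X + Y\<rfloor>" using that by (auto simp: a_def N_def)
    hence "of_int (a + int n) \<le> X + Y" by (simp add: le_floor_iff)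
    thus ?thesis by simp
  qed
  have "(\<Sum>n\<in>{n::int. X < of_int n \<and> of_int n \<le> X + Y}. e (f (of_int n))) = esum F N"
    unfolding esum_def
  proof (rule sum.reindex_bij_witness[of _ "\<lambda>n. a + int n" "\<lambda>n. nat (n - a)"])
    fix n :: int assume "n \<in> {n. X < of_int n \<and> of_int n \<le> X + Y}"
    hence n: "\<lfloor>X\<rfloor> < n" "n \<le> \<lfloor>X + Y\<rfloor>" by (auto simp: floor_less_iff le_floor_iff)
    thus "a + int (nat (n - a)) = n" "nat (n - a) \<in> {..<N}" by (auto simp: a_def N_def)
    have "real_of_int a + real (nat (n - a)) = of_int n" using n by (simp add: a_def)
    thus "e (F (nat (n - a))) = e (f (of_int n))" by (simp add: F_def)
  next
    fix n assume n: "n \<in> {..<N}"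
    show "nat (a + int n - a) = n" by simp
    show "a + int n \<in> {n. X < of_int n \<and> of_int n \<le> X + Y}"
      using aN[of n] n aX by auto
  qed
  hence lhs: "?lhs = norm (esum F N) / Y" using Y by (simp add: norm_divide)

  have diff: "differences_between (q + 2) lam Lam F N"
  proof (rule derivative_imp_differences_between[where a = "of_int a" and b = "X + Y" and fd = fd])
    fix k x assume "k < q + 2" "x \<in> {of_int a..X + Y}"
    thus "(fd k has_real_derivative fd (Suc k) x) (at x within {of_int a..X + Y})"
      by (intro DERIV_subset[OF hderiv]) (use aX q in auto)
  next
    fix x assume "x \<in> {of_int a..X + Y}"
    thus "lam \<le> fd (q + 2) x \<and> fd (q + 2) x \<le> Lam" using hbounds[of x] aX q by auto
  next
    fix n assume "n < N"
    thus "of_int a + real n \<le> X + Y" by (rule aN)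
    thus "F n = fd 0 (of_int a + real n)" using aX hf0[of "of_int a + real n"] by (simp add: F_def)
  qed

  define R where "R = ?M / constB"
  have M: "?M = constB * R" using B by (simp add: R_def)
  have ARG: "Lam / (lam * Y) > 0" "Lam\<^sup>2 / lam > 0" "lam * Y ^ d > 0" using hlam Lam Y by auto
  have Ra': "sqrt 2 * real q powr (2 / (4 * real Q)) * (Lam / (lam * Y)) powr (2 / (4 * real Q)) \<le> R"
    (is "?a \<le> R")
  proof -
    have "A_d d * (Lam / (lam * Y)) powr (2 / 2 ^ d) = constB * ?a"
      unfolding A_d_def D q(3) by (simp only: mult.assoc)
    hence "constB * ?a \<le> ?M" by (simp only: le_max_iff_disj order_refl simp_thms)
    thus ?thesis unfolding M using B by simp
  qed
  \<comment> \<open>Together with \<open>Lam\<close> and \<open>lam\<close> this is the base of the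
    power in the second term: \<open>3 ^ 4 / 2 ^ 3 * (2 / 3) ^ 4 = 2\<close> and
    \<open>D / 4 = Q\<close>.\<close>
  define G where "G = 2 ^ (Q + 1) * (2 / 3) ^ (2 * q) * constA\<^sup>2 / constB\<^sup>2"
  have G: "G > 0" using A B by (simp add: G_def)
  have Rb': "(G * (Lam\<^sup>2 / lam)) powr (1 / (4 * real Q - 2)) \<le> R" (is "?b \<le> R")
  proof -
    have "3 ^ 4 / 2 ^ 3 * (2 / 3) ^ (2 * d) * 2 powr (4 * real Q / 4) * constA\<^sup>2 * constB powr (-2) = G"
    proof -
      have "(2::real) powr (4 * real Q / 4) = 2 ^ Q" by (simp add: powr_realpow)
      moreover have "constB powr (-2) = 1 / constB\<^sup>2"
        using B by (simp add: powr_minus_divide powr_numeral)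
      moreover have "3 ^ 4 / 2 ^ 3 * (2 / 3) ^ (2 * d) = (2::real) * (2 / 3) ^ (2 * q)"
        by (simp add: q(2) power_add power_mult distrib_left)
      ultimately show ?thesis by (simp add: G_def)
    qed
    hence "B_d d * (Lam\<^sup>2 / lam) powr (1 / (2 ^ d - 2)) = constB * ?b"
      unfolding B_d_def D using G ARG by (simp only: powr_mult mult.assoc)
    hence "constB * ?b \<le> ?M" by (simp only: le_max_iff_disj order_refl simp_thms)
    thus ?thesis unfolding M using B by simp
  qed
  have Rc': "(constA * (4 * real Q) / constB) powr (4 / (4 * real Q)) * real q powr (2 * real q / (4 * real Q))
      * (lam * Y ^ d) powr (- 2 / (4 * real Q)) \<le> R" (is "?c \<le> R")
  proof -
    have "C_d d * (lam * Y ^ d) powr (- 2 / 2 ^ d) = constB * ?c"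
      unfolding C_d_def D q(3) by (simp only: mult.assoc)
    hence "constB * ?c \<le> ?M" by (simp only: le_max_iff_disj order_refl simp_thms)
    thus ?thesis unfolding M using B by simp
  qed
  have "?a > 0" using q(1) Lam hlam Y by simp
  hence R: "R > 0" using Ra' by linarith
  show ?thesis
  proof (cases "R \<le> 1")
    case False
    \<comment> \<open>For \<open>R > 1\<close> the trivial bound suffices, because
      \<open>2 <= constB\<close>.\<close>
    have "norm (esum F N) / Y \<le> (Y + 1) / Y"
      using norm_esum_le[of F N] N Y by (intro divide_right_mono) auto
    also have "(Y + 1) / Y \<le> 2" using Y by (simp add: field_simps)
    also have "2 \<le> constB" using constB_bounds by simp
    also have "\<dots> \<le> constB * R" using False B by simp
    finally show ?thesis unfolding lhs M .
  next
    case True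
    have Ra: "2 ^ Q * (Lam / (lam * Y)) \<le> R ^ (2 * Q)"
    proof -
      \<comment> \<open>The factor \<open>real q\<close>, at least 1, is the one that
        \<open>A_d\<close> carries.\<close>
      have "2 ^ Q * (1 * (Lam / (lam * Y))) \<le> 2 ^ Q * (real q * (Lam / (lam * Y)))"
        using q ARG by (intro mult_left_mono mult_right_mono) auto
      also have "\<dots> = ?a ^ (2 * Q)"
      proof -
        have "(x powr (2 / (4 * real Q))) ^ (2 * Q) = x" if "x > 0" for x
          by (rule powr_power_cancel) (use that Q in auto)
        moreover have "sqrt 2 ^ (2 * Q) = 2 ^ Q" by (simp add: power_mult)
        ultimately show ?thesis using q ARG by (simp add: power_mult_distrib)
      qed
      also have "\<dots> \<le> R ^ (2 * Q)" using Ra' \<open>?a > 0\<close> by (intro power_mono) auto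
      finally show ?thesis by simp
    qed
    have Rb: "G * (Lam\<^sup>2 / lam) \<le> R ^ (4 * Q - 2)"
    proof -
      have "real (4 * Q - 2) = 4 * real Q - 2" using Q by (simp add: of_nat_diff)
      hence "?b ^ (4 * Q - 2) = G * (Lam\<^sup>2 / lam)"
        by (intro powr_power_cancel mult_pos_pos G ARG) (use Q in auto)
      moreover have "?b ^ (4 * Q - 2) \<le> R ^ (4 * Q - 2)" using Rb' by (intro power_mono) auto
      ultimately show ?thesis by simp
    qed
    have Rc: "4 * 2 ^ q * constA / constB / sqrt (lam * Y ^ (q + 2)) \<le> R ^ Q"
    proof -
      have K: "constA * (4 * real Q) / constB > 0" using A B Q by simp
      \<comment> \<open>The power of \<open>q\<close> carried by \<open>C_d\<close> is at least 1
        and may be inserted.\<close>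
      have "1 \<le> (real q powr (2 * real q / (4 * real Q))) ^ Q"
        using q by (intro one_le_power ge_one_powr_ge_zero) auto
      hence "constA * (4 * real Q) / constB
        \<le> constA * (4 * real Q) / constB * (real q powr (2 * real q / (4 * real Q))) ^ Q"
        using K by (intro mult_le_cancel_left1[THEN iffD2]) auto
      hence "constA * (4 * real Q) / constB * (1 / sqrt (lam * Y ^ d))
        \<le> constA * (4 * real Q) / constB * (real q powr (2 * real q / (4 * real Q))) ^ Q * (1 / sqrt (lam * Y ^ d))"
        by (rule mult_right_mono) (use ARG in simp)
      also have "\<dots> = ?c ^ Q"
      proof -
        have "(x powr (4 / (4 * real Q))) ^ Q = x" if "x > 0" for x
          by (rule powr_power_cancel) (use that Q in auto)
        moreover have "(x powr (- 2 / (4 * real Q))) ^ Q = 1 / sqrt x" if "x > 0" for x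
          using that Q by (simp add: powr_realpow[symmetric] powr_powr powr_half_sqrt[symmetric] powr_minus_divide[symmetric])
        ultimately show ?thesis using K ARG by (simp add: power_mult_distrib)
      qed
      also have "\<dots> \<le> R ^ Q" using Rc' by (intro power_mono) auto
      finally show ?thesis by (simp add: q Q_def mult_ac)
    qed
    have "norm (esum F N) \<le> constB * R * Y"
      using norm_esum_le_of_differences[OF q(1) Y N hlam Lam(1) diff R True] Ra Rb Rc
      unfolding G_def Q_def by blast
    thus ?thesis unfolding lhs M using Y by (simp add: field_simps)
  qed
qed

end
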